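(* Let $k$ be an algebraically closed field of characteristic $p>0$, let $V$ be an $n$-dimensional vector space over $k$ and $V^*=\mathrm{Hom}_k(V,k)$ its dual. For $m,q\ge 1$ let $A_{m,q}$ be the coordinate ring of $V_{m,q}:=V^{\oplus m}\oplus V^{*\oplus q}$, with the action of $\mathrm{SL}(V)$ induced by the diagonal action of $\mathrm{SL}(V)$ on $V_{m,q}$. Then the invariant ring $A_{m,q}^{\mathrm{SL}(V)}$ is Frobenius split for any $m,q\geq n$.
   Context: $\mathrm{SL}(V)$ acts on $V$ by its defining representation and on $V^*$ by the dual representation. A commutative $k$-algebra $R$ (with $\mathrm{char}\,k=p>0$) is called Frobenius split if there is an additive map $\varphi\colon R\to R$ such that $\varphi(a^pb)=a\varphi(b)$ for all $a,b\in R$ and $\varphi(1)=1$. *)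

theory Defs
  imports
    "HOL-Combinatorics.Permutations"
    "HOL-Computational_Algebra.Polynomial"
    "HOL-Algebra.Ring"
begin

definition frobenius_split :: "nat \<Rightarrow> ('a, 'b) ring_scheme \<Rightarrow> bool" where
  "frobenius_split p R \<longleftrightarrow>
    (\<exists>\<phi> \<in> carrier R \<rightarrow> carrier R.
      (\<forall>a \<in> carrier R. \<forall>b \<in> carrier R. \<phi> (a \<oplus>\<^bsub>R\<^esub> b) = \<phi> a \<oplus>\<^bsub>R\<^esub> \<phi> b) \<and>
      (\<forall>a \<in> carrier R. \<forall>b \<in> carrier R. \<phi> (a [^]\<^bsub>R\<^esub> p \<otimes>\<^bsub>R\<^esub> b) = a \<otimes>\<^bsub>R\<^esub> \<phi> b) \<and>
      \<phi> \<one>\<^bsub>R\<^esub> = \<one>\<^bsub>R\<^esub>)"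


(* A vector space over 'k is given here by a carrier set W with operations vadd and vsmul.
   Over an infinite field its coordinate ring is the ring of polynomial functions on W, i.e. the
   subalgebra of all functions W -> 'k generated by the linear functionals.  Functions on W are
   represented as extensional functions (undefined outside W). *)

definition linear_functionals ::
    "'w set \<Rightarrow> ('w \<Rightarrow> 'w \<Rightarrow> 'w) \<Rightarrow> ('k::field \<Rightarrow> 'w \<Rightarrow> 'w) \<Rightarrow> ('w \<Rightarrow> 'k) set" where
  "linear_functionals W vadd vsmul =
    {l \<in> extensional W.
      (\<forall>x \<in> W. \<forall>y \<in> W. l (vadd x y) = l x + l y) \<and>
      (\<forall>c. \<forall>x \<in> W. l (vsmul c x) = c * l x)}"

inductive_set polynomial_functions ::
    "'w set \<Rightarrow> ('w \<Rightarrow> 'w \<Rightarrow> 'w) \<Rightarrow> ('k::field \<Rightarrow> 'w \<Rightarrow> 'w) \<Rightarrow> ('w \<Rightarrow> 'k) set"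
  for W vadd vsmul where
  const: "(\<lambda>w\<in>W. c) \<in> polynomial_functions W vadd vsmul"
| functional: "l \<in> linear_functionals W vadd vsmul \<Longrightarrow> l \<in> polynomial_functions W vadd vsmul"
| add: "f \<in> polynomial_functions W vadd vsmul \<Longrightarrow> g \<in> polynomial_functions W vadd vsmul \<Longrightarrow>
    (\<lambda>w\<in>W. f w + g w) \<in> polynomial_functions W vadd vsmul"
| mult: "f \<in> polynomial_functions W vadd vsmul \<Longrightarrow> g \<in> polynomial_functions W vadd vsmul \<Longrightarrow>
    (\<lambda>w\<in>W. f w * g w) \<in> polynomial_functions W vadd vsmul"

definition coordinate_ring ::
    "'w set \<Rightarrow> ('w \<Rightarrow> 'w \<Rightarrow> 'w) \<Rightarrow> ('k::field \<Rightarrow> 'w \<Rightarrow> 'w) \<Rightarrow> ('w \<Rightarrow> 'k) ring" where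
  "coordinate_ring W vadd vsmul =
    \<lparr>carrier = polynomial_functions W vadd vsmul,
     monoid.mult = (\<lambda>f g. \<lambda>w\<in>W. f w * g w),
     one = (\<lambda>w\<in>W. 1),
     zero = (\<lambda>w\<in>W. 0),
     add = (\<lambda>f g. \<lambda>w\<in>W. f w + g w)\<rparr>"


(* From here on V is the type 'v with scalar multiplication scale. *)

definition dual_space :: "('k::field \<Rightarrow> 'v::ab_group_add \<Rightarrow> 'v) \<Rightarrow> ('v \<Rightarrow> 'k) set" where
  "dual_space scale = {\<xi>. Vector_Spaces.linear scale (*) \<xi>}"

(* Leibniz formula for the matrix of g in the basis B; the value is independent of B. *)
definition endo_det ::
    "('k::field \<Rightarrow> 'v::ab_group_add \<Rightarrow> 'v) \<Rightarrow> 'v set \<Rightarrow> ('v \<Rightarrow> 'v) \<Rightarrow> 'k" where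
  "endo_det scale B g =
    (\<Sum>\<pi> | \<pi> permutes B. of_int (sign \<pi>) *
      (\<Prod>b\<in>B. module.representation scale B (g b) (\<pi> b)))"

definition special_linear ::
    "('k::field \<Rightarrow> 'v::ab_group_add \<Rightarrow> 'v) \<Rightarrow> 'v set \<Rightarrow> ('v \<Rightarrow> 'v) set" where
  "special_linear scale B =
    {g. Vector_Spaces.linear scale scale g \<and> bij g \<and> endo_det scale B g = 1}"

type_synonym ('k, 'v) point = "(nat \<Rightarrow> 'v) \<times> (nat \<Rightarrow> 'v \<Rightarrow> 'k)"

definition Vmq ::
    "('k::field \<Rightarrow> 'v::ab_group_add \<Rightarrow> 'v) \<Rightarrow> nat \<Rightarrow> nat \<Rightarrow> ('k, 'v) point set" where
  "Vmq scale m q = ({..<m} \<rightarrow>\<^sub>E UNIV) \<times> ({..<q} \<rightarrow>\<^sub>E dual_space scale)"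

definition Vmq_plus ::
    "nat \<Rightarrow> nat \<Rightarrow> ('k::field, 'v::ab_group_add) point \<Rightarrow> ('k, 'v) point \<Rightarrow> ('k, 'v) point" where
  "Vmq_plus m q = (\<lambda>(v, \<xi>) (v', \<xi>').
    ((\<lambda>i\<in>{..<m}. v i + v' i), (\<lambda>j\<in>{..<q}. \<lambda>x. \<xi> j x + \<xi>' j x)))"

definition Vmq_smul ::
    "('k::field \<Rightarrow> 'v::ab_group_add \<Rightarrow> 'v) \<Rightarrow> nat \<Rightarrow> nat \<Rightarrow>
      'k \<Rightarrow> ('k, 'v) point \<Rightarrow> ('k, 'v) point" where
  "Vmq_smul scale m q = (\<lambda>c (v, \<xi>).
    ((\<lambda>i\<in>{..<m}. scale c (v i)), (\<lambda>j\<in>{..<q}. \<lambda>x. c * \<xi> j x)))"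

definition Amq ::
    "('k::field \<Rightarrow> 'v::ab_group_add \<Rightarrow> 'v) \<Rightarrow> nat \<Rightarrow> nat \<Rightarrow> (('k, 'v) point \<Rightarrow> 'k) ring" where
  "Amq scale m q = coordinate_ring (Vmq scale m q) (Vmq_plus m q) (Vmq_smul scale m q)"

definition act_point ::
    "nat \<Rightarrow> nat \<Rightarrow> ('v \<Rightarrow> 'v) \<Rightarrow> ('k, 'v) point \<Rightarrow> ('k, 'v) point" where
  "act_point m q g = (\<lambda>(v, \<xi>).
    ((\<lambda>i\<in>{..<m}. g (v i)), (\<lambda>j\<in>{..<q}. \<xi> j \<circ> Hilbert_Choice.inv g)))"

definition act_function ::
    "('k::field \<Rightarrow> 'v::ab_group_add \<Rightarrow> 'v) \<Rightarrow> nat \<Rightarrow> nat \<Rightarrow>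
      ('v \<Rightarrow> 'v) \<Rightarrow> (('k, 'v) point \<Rightarrow> 'k) \<Rightarrow> ('k, 'v) point \<Rightarrow> 'k" where
  "act_function scale m q g f = (\<lambda>w\<in>Vmq scale m q. f (act_point m q (Hilbert_Choice.inv g) w))"

definition SL_invariant_ring ::
    "('k::field \<Rightarrow> 'v::ab_group_add \<Rightarrow> 'v) \<Rightarrow> 'v set \<Rightarrow> nat \<Rightarrow> nat \<Rightarrow>
      (('k, 'v) point \<Rightarrow> 'k) ring" where
  "SL_invariant_ring scale B m q =
    (Amq scale m q)\<lparr>carrier :=
      {f \<in> carrier (Amq scale m q). \<forall>g \<in> special_linear scale B. act_function scale m q g f = f}\<rparr>"


lemma polynomial_functions_extensional:
  "f \<in> polynomial_functions W vadd vsmul \<Longrightarrow> f \<in> extensional W"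
  by (induction rule: polynomial_functions.induct) (auto simp: linear_functionals_def extensional_def)

lemma linear_inv_bij:
  assumes "Vector_Spaces.linear scale scale g" "bij g"
  shows "Vector_Spaces.linear scale scale (Hilbert_Choice.inv g)"
proof -
  interpret g: Vector_Spaces.linear scale scale g by fact
  have gi: "g (Hilbert_Choice.inv g x) = x" and ig: "Hilbert_Choice.inv g (g x) = x" for x
    using assms(2) by (simp_all add: bij_is_surj surj_f_inv_f bij_is_inj)
  show ?thesis
  proof (unfold_locales, goal_cases)
    case (1 x y)
    then show ?case by (metis gi ig g.add)
  next
    case (2 c x)
    then show ?case by (metis gi ig g.scale)
  qed
qed

lemma act_point_closed:
  assumes "Vector_Spaces.linear scale scale g" "bij g" "w \<in> Vmq scale m q"
  shows "act_point m q g w \<in> Vmq scale m q"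
proof -
  have "\<xi> \<circ> Hilbert_Choice.inv g \<in> dual_space scale" if "\<xi> \<in> dual_space scale" for \<xi>
    using linear_inv_bij[OF assms(1,2)] that
    by (auto simp: dual_space_def intro: Vector_Spaces.linear_compose)
  then show ?thesis
    using assms(3) by (auto simp: Vmq_def act_point_def dest: PiE_mem)
qed

lemma special_linear_inv_closed:
  "g \<in> special_linear scale B \<Longrightarrow> w \<in> Vmq scale m q \<Longrightarrow> act_point m q (Hilbert_Choice.inv g) w \<in> Vmq scale m q"
  by (rule act_point_closed) (auto simp: special_linear_def linear_inv_bij bij_imp_bij_inv)

lemma cring_SL_invariant_ring:
  fixes scale :: "'k::field \<Rightarrow> 'v::ab_group_add \<Rightarrow> 'v"
  shows "cring (SL_invariant_ring scale B m q)"
proof -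
  let ?W = "Vmq scale m q"
  let ?P = "polynomial_functions ?W (Vmq_plus m q) (Vmq_smul scale m q)"
  let ?R = "SL_invariant_ring scale B m q"
  have car: "f \<in> carrier ?R \<longleftrightarrow> f \<in> ?P \<and> (\<forall>g \<in> special_linear scale B. \<forall>w \<in> ?W.
      f (act_point m q (Hilbert_Choice.inv g) w) = f w)" for f
    using polynomial_functions_extensional[of f]
    by (force simp: SL_invariant_ring_def Amq_def coordinate_ring_def act_function_def
        extensional_def fun_eq_iff restrict_def)
  have ops: "f \<otimes>\<^bsub>?R\<^esub> g = (\<lambda>w\<in>?W. f w * g w)" "f \<oplus>\<^bsub>?R\<^esub> g = (\<lambda>w\<in>?W. f w + g w)"
    "\<one>\<^bsub>?R\<^esub> = (\<lambda>w\<in>?W. 1)" "\<zero>\<^bsub>?R\<^esub> = (\<lambda>w\<in>?W. 0)" for f g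
    by (simp_all add: SL_invariant_ring_def Amq_def coordinate_ring_def)
  have ext: "f \<in> extensional ?W" if "f \<in> carrier ?R" for f
    using that car polynomial_functions_extensional by blast
  have cl: "(\<lambda>w\<in>?W. f w * g w) \<in> carrier ?R" "(\<lambda>w\<in>?W. f w + g w) \<in> carrier ?R"
    if "f \<in> carrier ?R" "g \<in> carrier ?R" for f g
    using that by (auto simp: car special_linear_inv_closed
        intro: polynomial_functions.add polynomial_functions.mult)
  have const: "(\<lambda>w\<in>?W. c) \<in> carrier ?R" for c
    by (auto simp: car special_linear_inv_closed intro: polynomial_functions.const)
  have eqI: "f = g" if "f \<in> extensional ?W" "g \<in> extensional ?W" "\<And>w. w \<in> ?W \<Longrightarrow> f w = g w"
    for f g :: "('k, 'v) point \<Rightarrow> 'k"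
    using that by (rule extensionalityI)
  show ?thesis
  proof (rule cringI)
    show "abelian_group ?R"
    proof (rule abelian_groupI)
      fix f assume f: "f \<in> carrier ?R"
      have "(\<lambda>w\<in>?W. (\<lambda>w\<in>?W. -1) w * f w) \<in> carrier ?R"
        using cl(1)[OF const f] .
      moreover have "(\<lambda>w\<in>?W. (\<lambda>w\<in>?W. -1) w * f w) \<oplus>\<^bsub>?R\<^esub> f = \<zero>\<^bsub>?R\<^esub>"
        by (auto simp: ops intro!: eqI)
      ultimately show "\<exists>g\<in>carrier ?R. g \<oplus>\<^bsub>?R\<^esub> f = \<zero>\<^bsub>?R\<^esub>" by blast
      show "\<zero>\<^bsub>?R\<^esub> \<oplus>\<^bsub>?R\<^esub> f = f"
        unfolding ops by (rule eqI) (simp_all add: ext f)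
    qed (auto simp: ops cl const ext algebra_simps intro!: eqI)
    show "comm_monoid ?R"
      by (rule comm_monoidI) (auto simp: ops cl const ext mult_ac intro!: eqI)
  qed (auto simp: ops cl const ext algebra_simps intro!: eqI)
qed

end

theory Submission
  imports Defs
begin

text \<open>
  Let \<open>x\<close> (the vectors) and \<open>y\<close> (the covectors) be the coordinates with respect to a basis. The trace of
  the polynomial ring is \<open>Tr f = (D f)\<^sup>1\<^sup>/\<^sup>p\<close>, where \<open>D\<close> is the product of the operators
  \<open>\<partial>\<^sup>p\<^sup>-\<^sup>1\<close> over all coordinates. It is \<open>p\<close>-inverse linear and commutes with unimodular linear
  substitutions. The splitting is \<open>f \<mapsto> c Tr (\<tau>\<^sup>p\<^sup>-\<^sup>1 f)\<close> for a suitable polynomial \<open>\<tau>\<close> and constant \<open>c\<close>.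

  No \<open>SL\<close>-invariant \<open>\<tau>\<close> works in general (for \<open>n = m = q = p = 2\<close> there is none), so \<open>\<tau>\<close> is only
  required to be invariant under the torus and of degree at most one along every simple positive root
  subgroup \<open>u(t)\<close>. For invariant \<open>f\<close> the \<open>p\<close>-th power of \<open>Tr (\<tau>\<^sup>p\<^sup>-\<^sup>1 f) (u(t) x)\<close> then has
  degree less than \<open>p\<close> in \<open>t\<close>, hence is constant, so \<open>Tr (\<tau>\<^sup>p\<^sup>-\<^sup>1 f)\<close> is invariant under the Borel
  subgroup. Restricted to an opposite root subgroup it is a polynomial both in \<open>t\<close> and in \<open>1/t\<close>, so it
  is invariant under the whole group.

  The section \<open>\<tau>\<close> is a product of minors of \<open>x\<close>, minors of \<open>y\<close> and pairings of a vector with a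
  covector whose leading monomials multiply to the product of all coordinates, so that
  \<open>Tr (\<tau>\<^sup>p\<^sup>-\<^sup>1)\<close> is a nonzero constant. The minors of full size exist because \<open>m, q \<ge> n\<close>.
\<close>

section \<open>Polynomial functions on a coordinate space\<close>

text \<open>Over a finite field the product of all X - a, plus 1, would be a nonconstant polynomial
  without a root.\<close>

lemma infinite_UNIV_alg_closed: "infinite (UNIV :: 'k::alg_closed_field set)"
proof
  assume fin: "finite (UNIV :: 'k set)"
  define P :: "'k poly" where "P = (\<Prod>a\<in>UNIV. [:- a, 1:])"
  have deg: "degree P = card (UNIV :: 'k set)"
    unfolding P_def by (subst degree_prod_eq_sum_degree) auto
  have "card (UNIV :: 'k set) > 0"
    using fin by (simp add: card_gt_0_iff)
  then have "degree (P + 1) > 0"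
    using deg by (subst degree_add_eq_left) auto
  then obtain x where "poly (P + 1) x = 0"
    using alg_closed_imp_poly_has_root by blast
  moreover have "poly P x = 0"
    using fin unfolding P_def by (simp add: poly_prod prod_zero_iff)
  ultimately show False by simp
qed

lemma poly_eqI_infinite:
  fixes P Q :: "'k::field poly"
  assumes "infinite S" "\<And>t. t \<in> S \<Longrightarrow> poly P t = poly Q t"
  shows "P = Q"
proof (rule ccontr)
  assume "P \<noteq> Q"
  then have "finite {t. poly (P - Q) t = 0}"
    by (intro poly_roots_finite) auto
  moreover have "S \<subseteq> {t. poly (P - Q) t = 0}"
    using assms(2) by auto
  ultimately show False
    using assms(1) finite_subset by blast
qed

lemma poly_eqI_alg_closed:
  fixes P Q :: "'k::alg_closed_field poly"
  assumes "\<And>t. poly P t = poly Q t"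
  shows "P = Q"
  by (rule poly_eqI_infinite[OF infinite_UNIV_alg_closed]) (use assms in auto)

section \<open>Monomials and the functions they span\<close>

definition mon :: "'i set \<Rightarrow> ('i \<Rightarrow> nat) \<Rightarrow> ('i \<Rightarrow> 'k::comm_ring_1) \<Rightarrow> 'k" where
  "mon I e x = (\<Prod>v\<in>I. x v ^ e v)"

text \<open>Adding one monomial at a time lets additive operators be checked on monomials, while the
  exponent set \<open>E\<close> records constraints on degree and weight. The elements are
  functions, not formal polynomials.\<close>

inductive_set mspan :: "'i set \<Rightarrow> ('i \<Rightarrow> nat) set \<Rightarrow> (('i \<Rightarrow> 'k::comm_ring_1) \<Rightarrow> 'k) set"
  for I E where
  zero: "(\<lambda>x. 0) \<in> mspan I E"
| step: "f \<in> mspan I E \<Longrightarrow> e \<in> E \<Longrightarrow> (\<lambda>x. f x + c * mon I e x) \<in> mspan I E"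

abbreviation Pol :: "'i set \<Rightarrow> (('i \<Rightarrow> 'k::comm_ring_1) \<Rightarrow> 'k) set" where
  "Pol I \<equiv> mspan I UNIV"

lemma mon_mult: "mon I e x * mon I e' x = mon I (\<lambda>v. e v + e' v) x"
  by (simp add: mon_def power_add prod.distrib)

lemma mspan_monomial: "e \<in> E \<Longrightarrow> (\<lambda>x. c * mon I e x) \<in> mspan I E"
  using mspan.step[OF mspan.zero, where e = e and c = c] by simp

lemma mspan_add:
  assumes "f \<in> mspan I E" "g \<in> mspan I E"
  shows "(\<lambda>x. f x + g x) \<in> mspan I E"
  using assms(2)
proof induction
  case (step g e c)
  then show ?case using mspan.step[OF step.IH step.hyps(2), where c = c] by (simp add: add.assoc)
qed (use assms in simp)

lemma mspan_mono: "f \<in> mspan I E \<Longrightarrow> E \<subseteq> E' \<Longrightarrow> f \<in> mspan I E'"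
  by (induction rule: mspan.induct) (auto intro: mspan.intros)

lemma mspan_Pol: "f \<in> mspan I E \<Longrightarrow> f \<in> Pol I"
  by (erule mspan_mono) simp

lemma mspan_mult_monomial:
  assumes "f \<in> mspan I E" "\<And>e. e \<in> E \<Longrightarrow> (\<lambda>v. e v + e' v) \<in> E'"
  shows "(\<lambda>x. f x * (c * mon I e' x)) \<in> mspan I E'"
  using assms(1)
proof induction
  case (step f e d)
  have "(\<lambda>x. f x * (c * mon I e' x) + (d * c) * mon I (\<lambda>v. e v + e' v) x) \<in> mspan I E'"
    by (intro mspan.step step.IH assms step.hyps)
  then show ?case by (simp add: algebra_simps flip: mon_mult)
qed (simp add: mspan.zero)

lemma mspan_mult:
  assumes "f \<in> mspan I E" "g \<in> mspan I E'"
    and "\<And>e e'. e \<in> E \<Longrightarrow> e' \<in> E' \<Longrightarrow> (\<lambda>v. e v + e' v) \<in> E''"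
  shows "(\<lambda>x. f x * g x) \<in> mspan I E''"
  using assms(2)
proof induction
  case (step g e' c)
  have "(\<lambda>x. f x * g x + f x * (c * mon I e' x)) \<in> mspan I E''"
    by (intro mspan_add step.IH mspan_mult_monomial[OF assms(1)] assms(3) step.hyps)
  then show ?case by (simp add: algebra_simps)
qed (simp add: mspan.zero)

lemma mspan_sum: "(\<And>a. a \<in> A \<Longrightarrow> f a \<in> mspan I E) \<Longrightarrow> (\<lambda>x. \<Sum>a\<in>A. f a x) \<in> mspan I E"
  by (induction A rule: infinite_finite_induct) (auto intro: mspan_add mspan.zero)

lemma Pol_mult: "f \<in> Pol I \<Longrightarrow> g \<in> Pol I \<Longrightarrow> (\<lambda>x. f x * g x) \<in> Pol I"
  by (rule mspan_mult) auto

lemma Pol_const: "(\<lambda>x. c) \<in> Pol I"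
  using mspan_monomial[where e = "\<lambda>_. 0" and E = UNIV and c = c and I = I] by (simp add: mon_def)

lemma mon_var:
  assumes "finite I" "v \<in> I"
  shows "mon I (\<lambda>u. if u = v then 1 else 0) x = x v"
  unfolding mon_def using assms by (subst prod.cong[OF refl, where h = "\<lambda>u. if u = v then x v else 1"]) auto

lemma Pol_var: "finite I \<Longrightarrow> v \<in> I \<Longrightarrow> (\<lambda>x. x v) \<in> Pol I"
  using mspan_monomial[where e = "\<lambda>u. if u = v then 1 else 0" and E = UNIV and c = 1 and I = I] by (simp add: mon_var)

lemma Pol_power: "f \<in> Pol I \<Longrightarrow> (\<lambda>x. f x ^ k) \<in> Pol I"
  by (induction k) (auto intro: Pol_const Pol_mult)

lemma Pol_prod: "(\<And>a. a \<in> A \<Longrightarrow> f a \<in> Pol I) \<Longrightarrow> (\<lambda>x. \<Prod>a\<in>A. f a x) \<in> Pol I"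
  by (induction A rule: infinite_finite_induct) (auto intro: Pol_mult Pol_const)

lemmas Pol_sum = mspan_sum[where E = UNIV]
lemmas Pol_add = mspan_add[where E = UNIV]
lemmas Pol_intros = Pol_const Pol_var Pol_add Pol_mult Pol_power Pol_sum Pol_prod

lemma Pol_diff: 
  assumes "f \<in> Pol I" "g \<in> Pol I" shows "(\<lambda>x. f x - g x) \<in> Pol I"
  using Pol_add[OF assms(1) Pol_mult[OF Pol_const[of "-1"] assms(2)]] by simp

lemma Pol_monomial: "(\<lambda>x. mon I e x) \<in> Pol I"
  using mspan_monomial[where e = e and E = UNIV and c = 1 and I = I] by simp

text \<open>Passes from induction over monomials to induction over ring generators, the form suited
  to composition and to the chain rule.\<close>

lemma Pol_induct [consumes 2, case_names const var add mult]:
  fixes f :: "('i \<Rightarrow> 'k::comm_ring_1) \<Rightarrow> 'k"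
  assumes "finite I" "f \<in> Pol I"
    and c: "\<And>c. P (\<lambda>x. c)" and v: "\<And>v. v \<in> I \<Longrightarrow> P (\<lambda>x. x v)"
    and a: "\<And>f g. f \<in> Pol I \<Longrightarrow> g \<in> Pol I \<Longrightarrow> P f \<Longrightarrow> P g \<Longrightarrow> P (\<lambda>x. f x + g x)"
    and m: "\<And>f g. f \<in> Pol I \<Longrightarrow> g \<in> Pol I \<Longrightarrow> P f \<Longrightarrow> P g \<Longrightarrow> P (\<lambda>x. f x * g x)"
  shows "P f"
proof -
  \<comment> \<open>The rule \<open>m\<close> asks for membership of both factors, so
    \<open>P\<close> and membership in \<open>Pol I\<close> are proved together.\<close>
  have pow: "P (\<lambda>x. x v ^ k) \<and> (\<lambda>x. x v ^ k :: 'k) \<in> Pol I" if "v \<in> I" for v k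
  proof (induction k)
    case (Suc k)
    then have k: "P (\<lambda>x. x v ^ k)" "(\<lambda>x. x v ^ k :: 'k) \<in> Pol I" by auto
    show ?case
      unfolding power_Suc
      by (intro conjI m Pol_mult v that k Pol_var assms(1))
  qed (use c in \<open>simp add: Pol_const\<close>)
  have mon: "P (\<lambda>x. mon J e x) \<and> (\<lambda>x. mon J e x :: 'k) \<in> Pol I" if "J \<subseteq> I" for J e
    using finite_subset[OF that assms(1)] that
  proof (induction J rule: finite_induct)
    case (insert v J)
    have "P (\<lambda>x. x v ^ e v * mon J e x)"
      using insert pow[of v "e v"] by (intro m) auto
    moreover have "(\<lambda>x. x v ^ e v * mon J e x :: 'k) \<in> Pol I"
      using insert pow[of v "e v"] by (intro Pol_mult) auto
    ultimately show ?case using insert by (simp add: mon_def)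
  qed (use c in \<open>simp_all add: mon_def[abs_def] Pol_const\<close>)
  have "P f \<and> f \<in> Pol I"
    using assms(2)
  proof induction
    case (step f e b)
    have "P (\<lambda>x. b * mon I e x)" "(\<lambda>x. b * mon I e x :: 'k) \<in> Pol I"
      using mon[of I e] by (auto intro!: m c Pol_mult Pol_const)
    with step show ?case by (auto intro!: a Pol_add)
  qed (use c in \<open>auto intro: Pol_const\<close>)
  then show ?thesis ..
qed

lemma Pol_compose:
  assumes "finite I" "f \<in> Pol I" "\<And>v. v \<in> I \<Longrightarrow> (\<lambda>x. A x v) \<in> Pol J"
  shows "(\<lambda>x. f (A x)) \<in> Pol J"
  using assms(1,2)
  by (induction rule: Pol_induct) (use assms(3) in \<open>auto intro: Pol_intros\<close>)

text \<open>Serves two kinds of curves: coordinate lines, which give partial derivatives, and orbits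
  of root subgroups.\<close>

lemma Pol_curve:
  assumes "finite I" "f \<in> Pol I" "\<And>v. v \<in> I \<Longrightarrow> \<exists>P. \<forall>t. y t v = poly P t"
  shows "\<exists>P. \<forall>t. f (y t) = poly P t"
  using assms(1,2)
proof (induction rule: Pol_induct)
  case (const c)
  show ?case by (rule exI[of _ "[:c:]"]) simp
next
  case (add f g)
  then show ?case by (metis poly_add)
next
  case (mult f g)
  then show ?case by (metis poly_mult)
qed (use assms(3) in blast)

lemma Pol_cong: 
  assumes "f \<in> Pol I" "\<And>v. v \<in> I \<Longrightarrow> x v = y v"
  shows "f x = f y"
  using assms(1)
proof induction
  case (step f e c)
  moreover have "mon I e x = mon I e y"
    unfolding mon_def by (intro prod.cong) (use assms(2) in auto)
  ultimately show ?case by simp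
qed simp

section \<open>Partial derivatives\<close>

text \<open>The derivative is read off from the restriction to the line through \<open>x\<close> in
  direction \<open>v\<close>, where the polynomial is unique because the field is infinite. The
  value 0 off \<open>Pol I\<close> makes these operators commute on all functions, as the fold
  defining \<open>D\<close> requires.\<close>

definition dif ::
    "'i set \<Rightarrow> 'i \<Rightarrow> (('i \<Rightarrow> 'k::alg_closed_field) \<Rightarrow> 'k) \<Rightarrow> ('i \<Rightarrow> 'k) \<Rightarrow> 'k" where
  "dif I v f x =
    (if f \<in> Pol I then poly (pderiv (THE P. \<forall>t. f (x(v := t)) = poly P t)) (x v) else 0)"

lemma dif_eqI:
  fixes f :: "('i \<Rightarrow> 'k::alg_closed_field) \<Rightarrow> 'k"
  assumes "f \<in> Pol I" "\<And>t. f (x(v := t)) = poly P t"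
  shows "dif I v f x = poly (pderiv P) (x v)"
proof -
  have "(THE P. \<forall>t. f (x(v := t)) = poly P t) = P"
    by (rule the_equality) (use assms in \<open>auto intro: poly_eqI_alg_closed\<close>)
  then show ?thesis using assms(1) by (simp add: dif_def)
qed

lemma univariate:
  assumes "finite I" "f \<in> Pol I"
  obtains P where "\<And>t. f (x(v := t)) = poly P t"
proof -
  have "\<exists>P. \<forall>t. f (x(v := t)) = poly P t"
  proof (rule Pol_curve[OF assms])
    fix u
    show "\<exists>P. \<forall>t. (x(v := t)) u = poly P t"
      by (cases "u = v") (auto intro: exI[of _ "[:0, 1:]"] exI[of _ "[:x u:]"])
  qed
  then show ?thesis using that by blast
qed

lemma dif_const: "dif I v (\<lambda>x. c) x = 0"
  by (subst dif_eqI[where P = "[:c:]"]) (auto simp: Pol_const)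

lemma dif_var:
  assumes "finite I" "u \<in> I"
  shows "dif I v (\<lambda>x. x u) x = (if u = v then 1 else 0)"
  by (subst dif_eqI[where P = "if u = v then [:0, 1:] else [:x u:]"])
     (auto simp: Pol_var assms pderiv_pCons)

lemma dif_add:
  assumes "finite I" "f \<in> Pol I" "g \<in> Pol I"
  shows "dif I v (\<lambda>x. f x + g x) x = dif I v f x + dif I v g x"
proof -
  obtain P Q where P: "\<And>t. f (x(v := t)) = poly P t" and Q: "\<And>t. g (x(v := t)) = poly Q t"
    using univariate[OF assms(1)] assms(2,3) by metis
  show ?thesis
    using dif_eqI[OF Pol_add[OF assms(2,3)], of x v "P + Q"] dif_eqI[OF assms(2) P]
      dif_eqI[OF assms(3) Q]
    by (simp add: P Q pderiv_add)
qed

lemma dif_mult: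
  assumes "finite I" "f \<in> Pol I" "g \<in> Pol I"
  shows "dif I v (\<lambda>x. f x * g x) x = f x * dif I v g x + dif I v f x * g x"
proof -
  obtain P Q where P: "\<And>t. f (x(v := t)) = poly P t" and Q: "\<And>t. g (x(v := t)) = poly Q t"
    using univariate[OF assms(1)] assms(2,3) by metis
  have "f x = poly P (x v)" "g x = poly Q (x v)"
    using P[of "x v"] Q[of "x v"] by simp_all
  then show ?thesis
    using dif_eqI[OF Pol_mult[OF assms(2,3)], of x v "P * Q"] dif_eqI[OF assms(2) P]
      dif_eqI[OF assms(3) Q]
    by (simp add: P Q pderiv_mult mult.commute)
qed

lemma dif_cmult:
  assumes "finite I" "f \<in> Pol I"
  shows "dif I v (\<lambda>x. c * f x) x = c * dif I v f x"
  using dif_mult[OF assms(1) Pol_const assms(2), of v c x] by (simp add: dif_const)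

lemma mon_remove:
  assumes "finite I" "v \<in> I"
  shows "mon I e x = x v ^ e v * mon (I - {v}) e x"
  unfolding mon_def using assms by (rule prod.remove)

lemma mon_cong: "(\<And>v. v \<in> I \<Longrightarrow> x v ^ e v = y v ^ e' v) \<Longrightarrow> mon I e x = mon I e' y"
  unfolding mon_def by (rule prod.cong) auto

lemma dif_mon:
  assumes "finite I" "v \<in> I"
  shows "dif I v (mon I e) x = of_nat (e v) * mon I (e(v := e v - 1)) x"
proof -
  have r: "mon (I - {v}) e (x(v := t)) = mon (I - {v}) e x"
    and r': "mon (I - {v}) (e(v := k)) x = mon (I - {v}) e x" for t k
    by (rule mon_cong; simp)+
  have "dif I v (mon I e) x = poly (pderiv (monom (mon (I - {v}) e x) (e v))) (x v)"
    by (rule dif_eqI[OF Pol_monomial])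
       (simp only: mon_remove[OF assms] r poly_monom fun_upd_same mult.commute)
  then show ?thesis
    by (simp add: pderiv_monom poly_monom mon_remove[OF assms] r' mult_ac)
qed

lemma dif_outside:
  assumes "v \<notin> I"
  shows "dif I v f = (\<lambda>x. 0)"
proof
  fix x show "dif I v f x = 0"
  proof (cases "f \<in> Pol I")
    case True
    have "f (x(v := t)) = poly [:f x:] t" for t
      using assms by (auto intro: Pol_cong[OF True])
    from dif_eqI[OF True this] show ?thesis by simp
  qed (simp add: dif_def)
qed

lemma dif_step:
  assumes "finite I" "f \<in> Pol I" "v \<in> I"
  shows "dif I v (\<lambda>x. f x + c * mon I e x) x =
    dif I v f x + (c * of_nat (e v)) * mon I (e(v := e v - 1)) x"
  using assms by (simp add: dif_add dif_cmult dif_mon Pol_mult Pol_const Pol_monomial)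

lemma dif_Pol:
  assumes "finite I"
  shows "dif I v f \<in> Pol I"
proof (cases "f \<in> Pol I \<and> v \<in> I")
  case True
  then have "f \<in> Pol I" by simp
  then show ?thesis
  proof induction
    case zero
    then show ?case by (simp add: dif_const[abs_def] Pol_const)
  next
    case (step f e c)
    have "dif I v (\<lambda>x. f x + c * mon I e x) =
        (\<lambda>x. dif I v f x + (c * of_nat (e v)) * mon I (e(v := e v - 1)) x)"
      using True dif_step[OF assms step.hyps(1)] by auto
    then show ?case using step.IH by (auto intro!: mspan.step)
  qed
next
  case False
  then have "dif I v f = (\<lambda>x. 0)" using dif_outside by (auto simp: dif_def)
  then show ?thesis by (simp add: Pol_const)
qed

lemma dif_commute:
  fixes f :: "('i \<Rightarrow> 'k::alg_closed_field) \<Rightarrow> 'k"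
  assumes "finite I"
  shows "dif I v (dif I w f) = dif I w (dif I v f)"
proof (cases "f \<in> Pol I \<and> v \<in> I \<and> w \<in> I")
  case True
  then have "f \<in> Pol I" by simp
  then show ?thesis
  proof induction
    case zero
    show ?case by (simp add: dif_const[abs_def])
  next
    case (step f e c)
    have 1: "dif I u (\<lambda>x. f x + c * mon I e x) =
        (\<lambda>x. dif I u f x + (c * of_nat (e u)) * mon I (e(u := e u - 1)) x)" if "u \<in> I" for u
      using dif_step[OF assms step.hyps(1) that] by auto
    let ?F = "\<lambda>x. f x + c * mon I e x"
    have 2: "dif I u (dif I u' ?F) x = dif I u (dif I u' f) x +
        (c * of_nat (e u') * of_nat ((e(u' := e u' - 1)) u)) *
          mon I ((e(u' := e u' - 1))(u := (e(u' := e u' - 1)) u - 1)) x"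
      if "u \<in> I" "u' \<in> I" for u u' x
      unfolding 1[OF that(2)] by (rule dif_step[OF assms dif_Pol[OF assms] that(1)])
    show ?case
    proof (cases "v = w")
      case False
      then have "(e(w := e w - 1))(v := e v - 1) = (e(v := e v - 1))(w := e w - 1)"
        by (simp add: fun_upd_twist)
      with True step.IH show ?thesis
        using False False[symmetric] by (intro ext) (simp only: 2 fun_upd_apply if_False mult_ac)
    qed simp
  qed
next
  case False
  have z: "dif I u (\<lambda>x. 0 :: 'k) = (\<lambda>x. 0)" for u
    by (auto simp: dif_const)
  from False have "v \<notin> I \<or> w \<notin> I \<or> (\<forall>u. dif I u f = (\<lambda>x. 0))"
    by (auto simp: dif_def)
  then show ?thesis
    by (elim disjE) (simp_all add: z dif_outside)
qed

text \<open>Both sides are additive in \<open>f\<close> and obey the same Leibniz rule, so constants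
  and coordinate functions decide.\<close>

lemma dif_compose:
  assumes "finite I" "f \<in> Pol I" "\<And>u. u \<in> I \<Longrightarrow> (\<lambda>x. A x u) \<in> Pol I"
  shows "dif I w (\<lambda>x. f (A x)) x = (\<Sum>u\<in>I. dif I w (\<lambda>x. A x u) x * dif I u f (A x))"
  using assms(1,2)
proof (induction rule: Pol_induct)
  case (var v)
  have "(\<Sum>u\<in>I. dif I w (\<lambda>x. A x u) x * dif I u (\<lambda>x. x v) (A x)) =
      (\<Sum>u\<in>I. if v = u then dif I w (\<lambda>x. A x u) x else 0)"
    by (intro sum.cong) (auto simp: dif_var assms(1) var)
  then show ?case using var assms(1) by simp
next
  case (add f g)
  have "(\<lambda>x. f (A x)) \<in> Pol I" "(\<lambda>x. g (A x)) \<in> Pol I"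
    by (rule Pol_compose[where A = A, OF assms(1) add.hyps(1) assms(3)],
      assumption) (rule Pol_compose[where A = A, OF assms(1) add.hyps(2) assms(3)])
  with add show ?case
    by (simp add: dif_add assms(1) sum.distrib algebra_simps)
next
  case (mult f g)
  have "(\<lambda>x. f (A x)) \<in> Pol I" "(\<lambda>x. g (A x)) \<in> Pol I"
    by (rule Pol_compose[where A = A, OF assms(1) mult.hyps(1) assms(3)],
      assumption) (rule Pol_compose[where A = A, OF assms(1) mult.hyps(2) assms(3)])
  with mult show ?case
    by (simp add: dif_mult assms(1) sum.distrib algebra_simps sum_distrib_left)
qed (simp add: dif_const)

section \<open>The trace in characteristic p\<close>

text \<open>Additivity of the p-th power turns equal powers of a and b into (a - b)^p = 0.\<close>

lemma pth_power_inj: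
  fixes a b :: "'k::alg_closed_field"
  assumes "CHAR('k) = p" "p > 0" "a ^ p = b ^ p"
  shows "a = b"
proof -
  have "prime CHAR('k)" using assms by (intro prime_CHAR_semidom) auto
  then have "((a - b) + b) ^ p = (a - b) ^ p + b ^ p"
    using assms(1) by (intro freshmans_dream) auto
  then show ?thesis using assms by simp
qed

lemma pth_root_exists:
  fixes a :: "'k::alg_closed_field"
  assumes "p > 0"
  obtains b where "b ^ p = a"
proof -
  have "degree (monom 1 p + [:- a:]) > 0"
    using assms by (subst degree_add_eq_left) (auto simp: degree_monom_eq)
  then obtain b where "poly (monom 1 p + [:- a:]) b = 0"
    using alg_closed_imp_poly_has_root by blast
  then show ?thesis using that by (simp add: poly_monom)
qed

locale frobenius_trace =
  fixes I :: "'i set" and p :: nat and k_type :: "'k::alg_closed_field itself"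
  assumes finite_I: "finite I" and CHAR: "CHAR('k) = p" and p_pos: "p > 0"
begin

lemma prime_p: "prime p"
  using CHAR p_pos prime_CHAR_semidom[where ?'a = 'k] by simp

lemma frobenius_add: "((a :: 'k) + b) ^ p = a ^ p + b ^ p"
  using prime_p CHAR by (intro freshmans_dream) auto

lemma frobenius_inj: "(a :: 'k) ^ p = b ^ p \<Longrightarrow> a = b"
  using pth_power_inj[OF CHAR p_pos] .

abbreviation d :: "'i \<Rightarrow> (('i \<Rightarrow> 'k) \<Rightarrow> 'k) \<Rightarrow> ('i \<Rightarrow> 'k) \<Rightarrow> 'k" where
  "d \<equiv> dif I"

text \<open>Partial derivatives commute, so the order of the fold is immaterial. A general
  \<open>J\<close> allows single coordinates to be split off.\<close>

definition D :: "'i set \<Rightarrow> (('i \<Rightarrow> 'k) \<Rightarrow> 'k) \<Rightarrow> ('i \<Rightarrow> 'k) \<Rightarrow> 'k" where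
  "D J f = Finite_Set.fold (\<lambda>v f. (d v ^^ (p - 1)) f) f J"

lemma funpow_d_Pol: "f \<in> Pol I \<Longrightarrow> (d v ^^ k) f \<in> Pol I"
  by (induction k) (auto intro: dif_Pol finite_I)

lemma funpow_d_commute: "(d v ^^ k) ((d w ^^ l) f) = (d w ^^ l) ((d v ^^ k) f)"
proof -
  have 1: "(d v ^^ k) (d w f) = d w ((d v ^^ k) f)" for k f
    by (induction k) (simp_all add: dif_commute[OF finite_I, of _ w])
  show ?thesis by (induction l) (simp_all add: 1)
qed

interpretation D: comp_fun_commute "\<lambda>v f. (d v ^^ (p - 1)) f"
  by unfold_locales (auto simp: fun_eq_iff funpow_d_commute[THEN fun_cong])

lemma D_empty [simp]: "D {} f = f"
  by (simp add: D_def)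

lemma D_insert: "finite J \<Longrightarrow> v \<notin> J \<Longrightarrow> D (insert v J) f = (d v ^^ (p - 1)) (D J f)"
  unfolding D_def by (rule D.fold_insert)

lemma D_insert2: "finite J \<Longrightarrow> v \<notin> J \<Longrightarrow> D (insert v J) f = D J ((d v ^^ (p - 1)) f)"
  unfolding D_def by (rule D.fold_insert2)

lemma D_Pol: "finite J \<Longrightarrow> f \<in> Pol I \<Longrightarrow> D J f \<in> Pol I"
  by (induction J rule: finite_induct) (simp_all add: D_insert funpow_d_Pol)

lemma funpow_d_add:
  assumes "f \<in> Pol I" "g \<in> Pol I"
  shows "(d v ^^ k) (\<lambda>x. f x + g x) = (\<lambda>x. (d v ^^ k) f x + (d v ^^ k) g x)"
proof (induction k)
  case (Suc k)
  then show ?case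
    using dif_add[OF finite_I funpow_d_Pol[OF assms(1), where v = v and k = k] funpow_d_Pol[OF assms(2), where v = v and k = k], where v = v]
    by auto
qed simp

lemma D_add:
  assumes "finite J" "f \<in> Pol I" "g \<in> Pol I"
  shows "D J (\<lambda>x. f x + g x) = (\<lambda>x. D J f x + D J g x)"
  using assms(1) by induction (simp_all add: D_insert funpow_d_add D_Pol assms)

text \<open>The power rule produces the factor p, which is 0 in the field. Hence p-th powers behave
  like constants under all partial derivatives.\<close>

lemma d_pth_power: "f \<in> Pol I \<Longrightarrow> d v (\<lambda>x. f x ^ p) x = 0"
proof -
  assume f: "f \<in> Pol I"
  have "d v (\<lambda>x. f x ^ Suc k) x = of_nat (Suc k) * f x ^ k * d v f x" for k
  proof (induction k)
    case (Suc k)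
    have "d v (\<lambda>x. f x * f x ^ Suc k) x = f x * d v (\<lambda>x. f x ^ Suc k) x + d v f x * f x ^ Suc k"
      by (rule dif_mult[OF finite_I f Pol_power[OF f]])
    also have "\<dots> = of_nat (Suc (Suc k)) * f x ^ Suc k * d v f x"
      unfolding Suc.IH by (simp add: algebra_simps)
    finally show ?case by simp
  qed simp
  from this[of "p - 1"] show ?thesis
    using p_pos CHAR of_nat_CHAR[where ?'a = 'k] by simp
qed

lemma funpow_d_pth_power_mult:
  assumes "f \<in> Pol I" "g \<in> Pol I"
  shows "(d v ^^ k) (\<lambda>x. f x ^ p * g x) = (\<lambda>x. f x ^ p * (d v ^^ k) g x)"
proof (induction k)
  case (Suc k)
  then show ?case
    using dif_mult[OF finite_I Pol_power[OF assms(1), of p] funpow_d_Pol[OF assms(2), where v = v and k = k], where v = v]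
    by (auto simp: d_pth_power assms)
qed simp

lemma D_pth_power_mult:
  assumes "finite J" "f \<in> Pol I" "g \<in> Pol I"
  shows "D J (\<lambda>x. f x ^ p * g x) = (\<lambda>x. f x ^ p * D J g x)"
  using assms(1) by induction (simp_all add: D_insert funpow_d_pth_power_mult D_Pol assms)

lemma D_cmult:
  assumes "finite J" "g \<in> Pol I"
  shows "D J (\<lambda>x. c * g x) = (\<lambda>x. c * D J g x)"
proof -
  \<comment> \<open>Every constant is a p-th power, so p-linearity covers scalars as well.\<close>
  obtain b where b: "b ^ p = c" using pth_root_exists[OF p_pos] .
  show ?thesis
    using D_pth_power_mult[OF assms(1) Pol_const[of b] assms(2)] by (simp add: b)
qed

text \<open>The coefficient is a falling factorial. Truncated subtraction is harmless: if
  \<open>k\<close> exceeds \<open>e v\<close>, the factor with j = \<open>e v\<close> is 0.\<close>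

lemma funpow_d_mon:
  assumes "v \<in> I"
  shows "(d v ^^ k) (\<lambda>x. c * mon I e x) =
    (\<lambda>x. c * of_nat (\<Prod>j<k. e v - j) * mon I (e(v := e v - k)) x)"
proof (induction k)
  case (Suc k)
  let ?e = "e(v := e v - k)" and ?c = "c * of_nat (\<Prod>j<k. e v - j)"
  have "(d v ^^ Suc k) (\<lambda>x. c * mon I e x) = d v (\<lambda>x. ?c * mon I ?e x)"
    by (simp only: funpow.simps comp_apply Suc)
  also have "\<dots> = (\<lambda>x. ?c * (of_nat (?e v) * mon I (?e(v := ?e v - 1)) x))"
    by (intro ext) (simp only: dif_cmult[OF finite_I Pol_monomial] dif_mon[OF finite_I assms])
  also have "?e(v := ?e v - 1) = e(v := e v - Suc k)" by simp
  finally show ?case by (simp add: mult_ac fun_upd_def)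
qed simp

text \<open>Among the p factors \<open>e v - j\<close> the one with j = \<open>e v mod p\<close> is
  a multiple of p.\<close>

lemma funpow_d_p: "v \<in> I \<Longrightarrow> f \<in> Pol I \<Longrightarrow> (d v ^^ p) f = (\<lambda>x. 0)"
proof -
  assume v: "v \<in> I" and "f \<in> Pol I"
  from this(2) show ?thesis
  proof induction
    case zero
    show ?case using funpow_d_mon[OF v, of p 0 "\<lambda>_. 0"] by simp
  next
    case (step f e c)
    have "e v mod p < p" "e v - e v mod p = p * (e v div p)"
      using p_pos by (simp_all add: minus_mod_eq_mult_div)
    then have "p dvd (\<Prod>j<p. e v - j)"
      by (metis dvd_prodI dvd_triv_left dvd_trans finite_lessThan lessThan_iff)
    then have "of_nat (\<Prod>j<p. e v - j) = (0 :: 'k)"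
      using CHAR by (metis of_nat_eq_0_iff_char_dvd)
    with step show ?case
      by (simp add: funpow_d_add funpow_d_mon[OF v] Pol_mult Pol_const Pol_monomial del: of_nat_prod)
  qed
qed

definition trace_coeff :: "('i \<Rightarrow> nat) \<Rightarrow> 'k" where
  "trace_coeff e = (\<Prod>v\<in>I. of_nat (\<Prod>j<p - 1. e v - j))"

lemma D_mon: "D I (\<lambda>x. c * mon I e x) = (\<lambda>x. c * trace_coeff e * mon I (\<lambda>v. e v - (p - 1)) x)"
proof -
  have "D J (\<lambda>x. c * mon I e x) = (\<lambda>x. c * (\<Prod>v\<in>J. of_nat (\<Prod>j<p - 1. e v - j)) *
      mon I (\<lambda>v. if v \<in> J then e v - (p - 1) else e v) x)" if "J \<subseteq> I" for J
    using finite_subset[OF that finite_I] that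
  proof (induction J rule: finite_induct)
    case (insert v J)
    let ?e = "\<lambda>u. if u \<in> J then e u - (p - 1) else e u"
    have "D (insert v J) (\<lambda>x. c * mon I e x) =
        (d v ^^ (p - 1)) (\<lambda>x. c * (\<Prod>v\<in>J. of_nat (\<Prod>j<p - 1. e v - j)) *
          mon I ?e x)"
      using insert by (simp only: D_insert insert_subset simp_thms)
    also have "\<dots> = (\<lambda>x. c * (\<Prod>v\<in>J. of_nat (\<Prod>j<p - 1. e v - j)) *
        of_nat (\<Prod>j<p - 1. ?e v - j) * mon I (?e(v := ?e v - (p - 1))) x)"
      using insert.prems by (intro funpow_d_mon) simp
    also have "?e(v := ?e v - (p - 1)) = (\<lambda>u. if u \<in> insert v J then e u - (p - 1) else e u)"
      using insert.hyps by auto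
    finally show ?case
      using insert.hyps by (simp add: mult_ac del: of_nat_prod One_nat_def)
  qed simp
  from this[of I] have "D I (\<lambda>x. c * mon I e x) = (\<lambda>x. c * trace_coeff e *
      mon I (\<lambda>v. if v \<in> I then e v - (p - 1) else e v) x)"
    by (simp add: trace_coeff_def)
  also have "mon I (\<lambda>v. if v \<in> I then e v - (p - 1) else e v) = (mon I (\<lambda>v. e v - (p - 1)) :: ('i \<Rightarrow> 'k) \<Rightarrow> 'k)"
    by (intro ext mon_cong) simp
  finally show ?thesis .
qed

text \<open>If the residue of \<open>e v\<close> is below p - 1, the factor with j equal to that
  residue occurs and is divisible by p. So only exponents congruent to -1 modulo p survive
  \<open>D I\<close>.\<close>

lemma trace_coeff_nonzero:
  assumes "trace_coeff e \<noteq> 0" "v \<in> I"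
  shows "e v mod p = p - 1"
proof (rule ccontr)
  assume "e v mod p \<noteq> p - 1"
  moreover have "e v mod p < p" using p_pos by simp
  ultimately have "e v mod p < p - 1" "e v - e v mod p = p * (e v div p)"
    by (simp_all add: minus_mod_eq_mult_div)
  then have "p dvd (\<Prod>j<p - 1. e v - j)"
    by (metis dvd_prodI dvd_triv_left dvd_trans finite_lessThan lessThan_iff)
  then have "of_nat (\<Prod>j<p - 1. e v - j) = (0 :: 'k)"
    using CHAR by (metis of_nat_eq_0_iff_char_dvd)
  then show False
    using assms finite_I by (auto simp: trace_coeff_def simp del: of_nat_prod)
qed

text \<open>Each coordinate contributes (p - 1)!, which is prime to p.\<close>

lemma trace_coeff_top: "trace_coeff (\<lambda>v. p - 1) \<noteq> 0"
proof -
  have "\<not> p dvd (\<Prod>j<p - 1. p - 1 - j)"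
    using prime_p by (auto simp: prime_dvd_prod_iff dest!: dvd_imp_le)
  then show ?thesis
    using finite_I CHAR by (auto simp: trace_coeff_def of_nat_eq_0_iff_char_dvd simp del: of_nat_prod)
qed

text \<open>Surviving exponents are congruent to -1 modulo p, so lowering them by p - 1 leaves
  multiples of p. The coefficients have p-th roots in the field, and roots of sums are sums of
  roots.\<close>

lemma D_pth_root:
  assumes "f \<in> Pol I"
  obtains g where "g \<in> Pol I" "\<And>x. g x ^ p = D I f x"
proof -
  have "\<exists>g\<in>Pol I. \<forall>x. g x ^ p = D I f x"
    using assms
  proof induction
    case zero
    have "D I (\<lambda>x. 0) = (\<lambda>x. 0)" using D_mon[of 0 "\<lambda>_. 0"] by simp
    then show ?case using p_pos by (intro bexI[of _ "\<lambda>x. 0"]) (auto intro: Pol_const)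
  next
    case (step f e c)
    then obtain g where g: "g \<in> Pol I" "\<And>x. g x ^ p = D I f x" by blast
    obtain b where b: "b ^ p = c * trace_coeff e" using pth_root_exists[OF p_pos] .
    \<comment> \<open>An exponent with residue p - 1 equals p * (\<open>e v div p\<close>) + (p -
      1), so \<open>e v div p\<close> is the exponent of the root.\<close>
    define h where "h = (\<lambda>x. b * mon I (\<lambda>v. e v div p) x)"
    have h: "h \<in> Pol I" unfolding h_def by (intro Pol_mult Pol_const Pol_monomial)
    have "h x ^ p = c * trace_coeff e * mon I (\<lambda>v. e v - (p - 1)) x" for x
    proof (cases "trace_coeff e = 0")
      case False
      have "mon I (\<lambda>v. e v div p) x ^ p = mon I (\<lambda>v. e v - (p - 1)) x"
        unfolding mon_def prod_power_distrib
      proof (rule prod.cong)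
        fix v assume "v \<in> I"
        then have "e v - (p - 1) = e v div p * p"
          using trace_coeff_nonzero[OF False] minus_mod_eq_div_mult[of "e v" p] by simp
        then show "(x v ^ (e v div p)) ^ p = x v ^ (e v - (p - 1))"
          by (simp add: power_mult)
      qed simp
      then show ?thesis by (simp add: h_def power_mult_distrib b)
    qed (use b p_pos in \<open>simp add: h_def power_mult_distrib\<close>)
    then have "(g x + h x) ^ p = D I (\<lambda>x. f x + c * mon I e x) x" for x
      using step.hyps D_mon[of c e]
      by (simp add: frobenius_add g D_add finite_I Pol_mult Pol_const Pol_monomial)
    then show ?case by (intro bexI[of _ "\<lambda>x. g x + h x"] Pol_add g h) auto
  qed
  then show ?thesis using that by blast
qed

section \<open>The trace and its behaviour under linear substitutions\<close>

definition Tr :: "(('i \<Rightarrow> 'k) \<Rightarrow> 'k) \<Rightarrow> ('i \<Rightarrow> 'k) \<Rightarrow> 'k" where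
  "Tr f x = (THE y. y ^ p = D I f x)"

lemma Tr_pth_power: "Tr f x ^ p = D I f x"
proof -
  obtain y where y: "y ^ p = D I f x" using pth_root_exists[OF p_pos] .
  show ?thesis
    unfolding Tr_def by (rule theI[of _ y]) (auto simp: y intro: frobenius_inj)
qed

text \<open>Frobenius is injective, so identities for \<open>Tr\<close> may be checked after raising
  to the p-th power.\<close>

lemma Tr_eqI: "y ^ p = D I f x \<Longrightarrow> Tr f x = y"
  using Tr_pth_power frobenius_inj by metis

lemma Tr_Pol: 
  assumes "f \<in> Pol I" shows "Tr f \<in> Pol I"
proof -
  obtain g where "g \<in> Pol I" "\<And>x. g x ^ p = D I f x"
    using D_pth_root[OF assms] by blast
  moreover from this have "Tr f = g" by (auto intro: Tr_eqI)
  ultimately show ?thesis by simp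
qed

lemma Tr_add: "f \<in> Pol I \<Longrightarrow> g \<in> Pol I \<Longrightarrow> Tr (\<lambda>x. f x + g x) x = Tr f x + Tr g x"
  by (rule Tr_eqI) (simp add: frobenius_add Tr_pth_power D_add finite_I)

lemma Tr_pth_power_mult: "f \<in> Pol I \<Longrightarrow> g \<in> Pol I \<Longrightarrow> Tr (\<lambda>x. f x ^ p * g x) x = f x * Tr g x"
  by (rule Tr_eqI) (simp add: power_mult_distrib Tr_pth_power D_pth_power_mult finite_I)

text \<open>Under the substitution \<open>A\<close> only the derivative in \<open>w\<close> changes:
  it acquires t times the derivative in \<open>v\<close>. After p - 1 derivatives in
  \<open>v\<close> a further one gives 0, so the extra term disappears.\<close>

lemma D_shear:
  fixes t :: 'k
  assumes vw: "v \<in> I" "w \<in> I" "v \<noteq> w" and f: "f \<in> Pol I"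
  defines "A \<equiv> \<lambda>x :: 'i \<Rightarrow> 'k. x(v := x v + t * x w)"
  shows "D I (\<lambda>x. f (A x)) = (\<lambda>x. D I f (A x))"
proof -
  have A: "(\<lambda>x. A x u) \<in> Pol I" if "u \<in> I" for u
    using that vw by (cases "u = v") (simp_all add: A_def Pol_intros finite_I)
  have dA: "d u' (\<lambda>x. A x u) x = (if u = u' then 1 else 0) + (if u = v \<and> u' = w then t else 0)"
    if "u \<in> I" for u u' x
    using that vw
    by (cases "u = v") (auto simp: A_def dif_var dif_add dif_cmult finite_I Pol_intros)
  have chain: "d u (\<lambda>x. g (A x)) = (\<lambda>x. d u g (A x) + (if u = w then t * d v g (A x) else 0))"
    if "g \<in> Pol I" "u \<in> I" for g u
  proof
    fix x
    have "d u (\<lambda>x. g (A x)) x = (\<Sum>u'\<in>I. d u (\<lambda>x. A x u') x * d u' g (A x))"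
      by (rule dif_compose[OF finite_I that(1) A])
    also have "\<dots> = (\<Sum>u'\<in>I. (if u' = u then d u' g (A x) else 0) +
        (if u' = v then (if u = w then t * d u' g (A x) else 0) else 0))"
      using vw(3) by (intro sum.cong) (auto simp: dA)
    also have "\<dots> = d u g (A x) + (if u = w then t * d v g (A x) else 0)"
      using that vw finite_I by (simp add: sum.distrib)
    finally show "d u (\<lambda>x. g (A x)) x = d u g (A x) + (if u = w then t * d v g (A x) else 0)" .
  qed
  have pow: "(d u ^^ k) (\<lambda>x. g (A x)) = (\<lambda>x. (d u ^^ k) g (A x))"
    if "g \<in> Pol I" "u \<in> I" "u \<noteq> w" for g u k
    by (induction k) (simp_all add: chain funpow_d_Pol that)
  have poww: "(d w ^^ k) (\<lambda>x. g (A x)) = (\<lambda>x. (d w ^^ k) g (A x))"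
    if "g \<in> Pol I" "d v g = (\<lambda>x. 0)" for g k
  proof (induction k)
    case (Suc k)
    have "d v ((d w ^^ k) g) = (d w ^^ k) (d v g)"
      using funpow_d_commute[of 1 v k w g] by simp
    also have "\<dots> = (\<lambda>x. 0)"
      unfolding that(2) using funpow_d_mon[OF vw(2), of k 0 "\<lambda>_. 0"] by simp
    finally show ?case using Suc chain[OF funpow_d_Pol[OF that(1)] vw(2)] by simp
  qed simp
  define J where "J = I - {v, w}"
  have J: "finite J" "v \<notin> J" "w \<notin> J" "I = insert w (insert v J)" "J \<subseteq> I"
    using finite_I vw by (auto simp: J_def)
  \<comment> \<open>The derivatives in \<open>v\<close> are put innermost, so that those in
    \<open>w\<close> act on a function already killed by \<open>d v\<close>.\<close>
  have Dsplit: "D I g = D J ((d w ^^ (p - 1)) ((d v ^^ (p - 1)) g))" for g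
    using arg_cong[OF J(4), of "\<lambda>K. D K g"] J(1-3) vw(3)
    by (simp add: D_insert2 funpow_d_commute[where v = w and w = v])
  have DJ: "D K (\<lambda>x. g (A x)) = (\<lambda>x. D K g (A x))" if "finite K" "K \<subseteq> J" "g \<in> Pol I" for K g
    using that
  proof (induction K rule: finite_induct)
    case (insert u K)
    then have "u \<in> I" "u \<noteq> w" using J(3,5) by auto
    with insert show ?case by (simp add: D_insert pow D_Pol)
  qed simp
  have "d v ((d v ^^ (p - 1)) f) = (\<lambda>x. 0)"
    using funpow_d_p[OF vw(1) f] p_pos by (metis Suc_diff_1 comp_apply funpow.simps(2))
  then show ?thesis
    unfolding Dsplit using J(1-3,5) vw f by (simp add: pow poww funpow_d_Pol DJ)
qed

text \<open>Each derivative in \<open>u\<close> brings out one factor \<open>c u\<close>. For a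
  substitution of determinant one the total factor is 1.\<close>

lemma D_scale:
  assumes f: "f \<in> Pol I"
  shows "D I (\<lambda>x. f (\<lambda>u. c u * x u)) = (\<lambda>x. (\<Prod>u\<in>I. c u ^ (p - 1)) * D I f (\<lambda>u. c u * x u))"
proof -
  let ?A = "\<lambda>x u. c u * x u"
  have A: "(\<lambda>x. ?A x u) \<in> Pol I" if "u \<in> I" for u
    using that by (simp add: Pol_intros finite_I)
  have chain: "d u (\<lambda>x. g (?A x)) = (\<lambda>x. c u * d u g (?A x))" if "g \<in> Pol I" "u \<in> I" for g u
  proof
    fix x
    have "d u (\<lambda>x. g (?A x)) x = (\<Sum>u'\<in>I. d u (\<lambda>x. ?A x u') x * d u' g (?A x))"
      by (rule dif_compose[OF finite_I that(1) A])
    also have "\<dots> = (\<Sum>u'\<in>I. if u' = u then c u * d u g (?A x) else 0)"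
      by (intro sum.cong) (auto simp: dif_cmult dif_var finite_I Pol_intros)
    finally show "d u (\<lambda>x. g (?A x)) x = c u * d u g (?A x)"
      using that finite_I by simp
  qed
  have comp: "(\<lambda>x. g (?A x)) \<in> Pol I" if "g \<in> Pol I" for g
    by (rule Pol_compose[OF finite_I that A])
  have pow: "(d u ^^ k) (\<lambda>x. a * g (?A x)) = (\<lambda>x. a * c u ^ k * (d u ^^ k) g (?A x))"
    if "g \<in> Pol I" "u \<in> I" for g u k a
  proof (induction k)
    case (Suc k)
    let ?h = "(d u ^^ k) g"
    have h: "?h \<in> Pol I" using that(1) by (rule funpow_d_Pol)
    have "(d u ^^ Suc k) (\<lambda>x. a * g (?A x)) = d u (\<lambda>x. a * c u ^ k * ?h (?A x))"
      by (simp only: funpow.simps comp_apply Suc)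
    also have "\<dots> = (\<lambda>x. a * c u ^ k * (c u * d u ?h (?A x)))"
      by (intro ext) (simp only: dif_cmult[OF finite_I comp[OF h]] chain[OF h that(2)])
    finally show ?case by (simp add: mult.assoc mult.left_commute)
  qed simp
  have "D J (\<lambda>x. f (?A x)) = (\<lambda>x. (\<Prod>u\<in>J. c u ^ (p - 1)) * D J f (?A x))" if "finite J" "J \<subseteq> I" for J
    using that by (induction J rule: finite_induct) (auto simp: D_insert pow D_Pol f mult.assoc mult.left_commute)
  then show ?thesis using finite_I by simp
qed

text \<open>The image of \<open>S\<close> under \<open>s\<close> avoids \<open>S\<close>, so no
  shear alters an entry that another one reads, and the simultaneous substitution is a composite of
  single shears.\<close>

lemma D_shears:
  fixes t :: "'i \<Rightarrow> 'k"
  assumes "finite S" "S \<subseteq> I" "s ` S \<subseteq> I - S" "f \<in> Pol I"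
  defines "A \<equiv> \<lambda>S (x :: 'i \<Rightarrow> 'k) u. if u \<in> S then x u + t u * x (s u) else x u"
  shows "D I (\<lambda>x. f (A S x)) = (\<lambda>x. D I f (A S x))"
  using assms(1-4)
proof (induction S arbitrary: f rule: finite_induct)
  case empty
  then show ?case by (simp add: A_def)
next
  case (insert v S)
  let ?L = "\<lambda>x. x(v := x v + t v * x (s v))"
  have eq: "A (insert v S) x = ?L (A S x)" for x
    using insert by (auto simp: A_def fun_eq_iff)
  have L: "(\<lambda>x. f (?L x)) \<in> Pol I"
  proof (rule Pol_compose[OF finite_I insert.prems(3)])
    fix u assume "u \<in> I"
    then show "(\<lambda>x. (?L x) u) \<in> Pol I"
      using insert.prems by (cases "u = v") (auto intro!: Pol_add Pol_mult Pol_const Pol_var finite_I)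
  qed
  have "D I (\<lambda>x. f (?L (A S x))) = (\<lambda>x. D I (\<lambda>x. f (?L x)) (A S x))"
    using insert L by (intro insert.IH[of "\<lambda>x. f (?L x)"]) auto
  also have "D I (\<lambda>x. f (?L x)) = (\<lambda>x. D I f (?L x))"
    using insert.prems by (intro D_shear) auto
  finally show ?case by (simp add: eq fun_upd_def)
qed

end

section \<open>Minors and leading monomials\<close>

text \<open>Rows and columns share the index set \<open>S\<close>, as in \<open>endo_det\<close>.
  For a minor the choice of columns is built into \<open>M\<close>.\<close>

definition ldet :: "'a set \<Rightarrow> ('a \<Rightarrow> 'a \<Rightarrow> 'k::comm_ring_1) \<Rightarrow> 'k" where
  "ldet S M = (\<Sum>\<pi> | \<pi> permutes S. of_int (sign \<pi>) * (\<Prod>b\<in>S. M b (\<pi> b)))"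

lemma ldet_cong:
  assumes "\<And>a b. a \<in> S \<Longrightarrow> b \<in> S \<Longrightarrow> M a b = N a b"
  shows "ldet S M = ldet S N"
  unfolding ldet_def
  by (intro sum.cong refl arg_cong2[where f = "(*)"] prod.cong) (auto simp: assms permutes_in_image)

lemma ldet_row_linear:
  assumes "finite S" "r \<in> S"
  shows "ldet S (M(r := \<lambda>c. M r c + t * N c)) = ldet S M + t * ldet S (M(r := N))"
proof -
  have "(\<Prod>b\<in>S. (M(r := \<lambda>c. M r c + t * N c)) b (\<pi> b)) =
      (\<Prod>b\<in>S. M b (\<pi> b)) + t * (\<Prod>b\<in>S. (M(r := N)) b (\<pi> b))" for \<pi>
  proof -
    have "(\<Prod>b\<in>S - {r}. (M(r := K)) b (\<pi> b)) = (\<Prod>b\<in>S - {r}. M b (\<pi> b))" for K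
      by (rule prod.cong) auto
    then show ?thesis
      using assms by (simp add: prod.remove[of S r] algebra_simps del: fun_upd_apply)
        (simp add: algebra_simps)
  qed
  then show ?thesis
    by (simp add: ldet_def algebra_simps sum.distrib sum_distrib_left)
qed

text \<open>Splitting into even and odd permutations avoids dividing by 2, which is needed in
  characteristic 2.\<close>

lemma ldet_identical_rows:
  assumes "finite S" "a \<in> S" "b \<in> S" "a \<noteq> b" "\<And>c. c \<in> S \<Longrightarrow> M a c = M b c"
  shows "ldet S M = 0"
proof -
  let ?\<tau> = "Transposition.transpose a b"
  let ?P = "\<lambda>\<pi>. \<Prod>b\<in>S. M b (\<pi> b)"
  have \<tau>: "?\<tau> permutes S" using assms by (intro permutes_swap_id)
  have P: "?P (\<pi> \<circ> ?\<tau>) = ?P \<pi>" if "\<pi> permutes S" for \<pi>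
  proof -
    have "?P (\<pi> \<circ> ?\<tau>) = (\<Prod>c\<in>S. M (?\<tau> c) (\<pi> (?\<tau> c)))"
      using assms that by (intro prod.cong) (auto simp: Transposition.transpose_def permutes_in_image)
    also have "\<dots> = ?P \<pi>"
      using prod.permute[OF \<tau>, of "\<lambda>c. M c (\<pi> c)"] by (simp add: comp_def)
    finally show ?thesis .
  qed
  have sg: "sign (\<pi> \<circ> ?\<tau>) = - sign \<pi>" if "\<pi> permutes S" for \<pi>
    using assms that permutes_imp_permutation[OF assms(1)] \<tau>
    by (subst sign_compose) (auto simp: sign_swap_id)
  let ?E = "{\<pi>. \<pi> permutes S \<and> sign \<pi> = 1}" and ?O = "{\<pi>. \<pi> permutes S \<and> sign \<pi> = - 1}"
  have fin: "finite {\<pi>. \<pi> permutes S}" by (rule finite_permutations) fact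
  have "sign \<pi> = 1 \<or> sign \<pi> = - 1" for \<pi> :: "'a \<Rightarrow> 'a" by (rule sign_cases[of \<pi>]) auto
  then have split: "{\<pi>. \<pi> permutes S} = ?E \<union> ?O" by auto
  have "ldet S M = (\<Sum>\<pi>\<in>?E. ?P \<pi>) + (\<Sum>\<pi>\<in>?O. - ?P \<pi>)"
    unfolding ldet_def split
    by (subst sum.union_disjoint) (use fin in \<open>auto intro!: arg_cong2[where f = "(+)"] sum.cong elim: finite_subset[rotated]\<close>)
  also have "(\<Sum>\<pi>\<in>?O. - ?P \<pi>) = (\<Sum>\<pi>\<in>?E. - ?P \<pi>)"
    by (rule sum.reindex_bij_witness[where i = "\<lambda>\<pi>. \<pi> \<circ> ?\<tau>" and j = "\<lambda>\<pi>. \<pi> \<circ> ?\<tau>"])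
       (auto simp: sg P[unfolded comp_apply] comp_assoc intro: permutes_compose[OF \<tau>])
  finally show ?thesis by (simp add: sum_negf)
qed

lemma ldet_add_row:
  assumes "finite S" "a \<in> S" "b \<in> S" "a \<noteq> b"
  shows "ldet S (M(a := \<lambda>c. M a c + t * M b c)) = ldet S M"
  using ldet_identical_rows[OF assms, of "M(a := M b)"] ldet_row_linear[OF assms(1,2), where M = M and t = t and N = "M b"] assms(4)
  by simp

lemma ldet_scale_rows: "ldet S (\<lambda>a c. s a * M a c) = (\<Prod>a\<in>S. s a) * ldet S M"
  by (simp add: ldet_def prod.distrib sum_distrib_left mult_ac)

lemma ldet_Pol:
  assumes "\<And>a b. a \<in> S \<Longrightarrow> b \<in> S \<Longrightarrow> (\<lambda>x. M x a b) \<in> Pol I"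
  shows "(\<lambda>x. ldet S (M x)) \<in> Pol I"
  unfolding ldet_def
  by (intro Pol_sum Pol_mult Pol_const Pol_prod assms) (auto simp: permutes_in_image)

section \<open>Exponent vectors and leading monomials\<close>

definition expo :: "'a set \<Rightarrow> ('a \<Rightarrow> 'i) \<Rightarrow> 'i \<Rightarrow> nat" where
  "expo A u v = (\<Sum>a\<in>A. if u a = v then 1 else 0)"

lemma mon_expo:
  assumes "finite I" "finite A" "u ` A \<subseteq> I"
  shows "mon I (expo A u) x = (\<Prod>a\<in>A. x (u a))"
proof -
  have "mon I (expo A u) x = (\<Prod>v\<in>I. \<Prod>a\<in>A. if u a = v then x v else 1)"
    unfolding mon_def expo_def power_sum by (intro prod.cong) auto
  also have "\<dots> = (\<Prod>a\<in>A. \<Prod>v\<in>I. if v = u a then x (u a) else 1)"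
    by (subst prod.swap) (auto intro!: prod.cong)
  also have "\<dots> = (\<Prod>a\<in>A. x (u a))"
    using assms by (intro prod.cong) (auto simp: prod.delta)
  finally show ?thesis .
qed

lemma sum_expo:
  fixes w :: "'i \<Rightarrow> int"
  assumes "finite I" "finite A" "u ` A \<subseteq> I"
  shows "(\<Sum>v\<in>I. w v * int (expo A u v)) = (\<Sum>a\<in>A. w (u a))"
proof -
  have "(\<Sum>v\<in>I. w v * int (expo A u v)) = (\<Sum>v\<in>I. \<Sum>a\<in>A. if u a = v then w v else 0)"
    unfolding expo_def of_nat_sum sum_distrib_left by (intro sum.cong) auto
  also have "\<dots> = (\<Sum>a\<in>A. \<Sum>v\<in>I. if v = u a then w (u a) else 0)"
    by (subst sum.swap) (auto intro!: sum.cong)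
  also have "\<dots> = (\<Sum>a\<in>A. w (u a))"
    using assms by (intro sum.cong) (auto simp: sum.delta)
  finally show ?thesis .
qed

text \<open>All monomials are required to have the same degree, and the leading one is the unique one
  of least weight.\<close>

definition lead :: "'i set \<Rightarrow> ('i \<Rightarrow> int) \<Rightarrow> (('i \<Rightarrow> 'k::comm_ring_1) \<Rightarrow> 'k) \<Rightarrow> ('i \<Rightarrow> nat) \<Rightarrow> bool" where
  "lead I w f e \<longleftrightarrow> (\<exists>R \<in> mspan I {e'. (\<Sum>v\<in>I. int (e' v)) = (\<Sum>v\<in>I. int (e v)) \<and>
      (\<Sum>v\<in>I. w v * int (e' v)) > (\<Sum>v\<in>I. w v * int (e v))}. f = (\<lambda>x. mon I e x + R x))"

lemma lead_Pol: "lead I w f e \<Longrightarrow> f \<in> Pol I"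
  by (auto simp: lead_def intro!: Pol_add Pol_monomial mspan_Pol)

lemma lead_cong:
  assumes "lead I w f e" "\<And>v. v \<in> I \<Longrightarrow> e v = e' v"
  shows "lead I w f e'"
proof -
  have "mon I e = (mon I e' :: _ \<Rightarrow> 'b)" by (intro ext mon_cong) (simp add: assms(2))
  moreover have "(\<Sum>v\<in>I. int (e v)) = (\<Sum>v\<in>I. int (e' v))"
    "(\<Sum>v\<in>I. w v * int (e v)) = (\<Sum>v\<in>I. w v * int (e' v))"
    by (intro sum.cong; simp add: assms(2))+
  ultimately show ?thesis using assms(1) by (simp add: lead_def)
qed

lemma lead_1: "lead I w (\<lambda>x. 1) (\<lambda>v. 0)"
  unfolding lead_def by (intro bexI[of _ "\<lambda>x. 0"] mspan.zero) (simp add: mon_def)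

text \<open>Weights add, so each of the three products involving a remainder has weight strictly
  above that of the product of the leading monomials.\<close>

lemma lead_mult:
  assumes "lead I w f e" "lead I w g e'"
  shows "lead I w (\<lambda>x. f x * g x) (\<lambda>v. e v + e' v)"
proof -
  let ?deg = "\<lambda>e. \<Sum>v\<in>I. int (e v)" and ?wt = "\<lambda>e. \<Sum>v\<in>I. w v * int (e v)"
  let ?E = "\<lambda>e. {e'. ?deg e' = ?deg e \<and> ?wt e' > ?wt e}"
  let ?s = "\<lambda>v. e v + e' v"
  obtain R R' where R: "R \<in> mspan I (?E e)" "f = (\<lambda>x. mon I e x + R x)"
    and R': "R' \<in> mspan I (?E e')" "g = (\<lambda>x. mon I e' x + R' x)"
    using assms unfolding lead_def by blast
  have "(\<lambda>x. R x * (1 * mon I e' x)) \<in> mspan I (?E ?s)"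
    by (rule mspan_mult_monomial[OF R(1)]) (auto simp: sum.distrib distrib_left)
  moreover have "(\<lambda>x. R' x * (1 * mon I e x)) \<in> mspan I (?E ?s)"
    by (rule mspan_mult_monomial[OF R'(1)]) (auto simp: sum.distrib distrib_left)
  moreover have "(\<lambda>x. R x * R' x) \<in> mspan I (?E ?s)"
    by (rule mspan_mult[OF R(1) R'(1)]) (auto simp: sum.distrib distrib_left)
  ultimately have "(\<lambda>x. (R x * (1 * mon I e' x) + R' x * (1 * mon I e x)) + R x * R' x) \<in> mspan I (?E ?s)"
    by (intro mspan_add)
  then show ?thesis
    unfolding lead_def R(2) R'(2)
    by (rule bexI[rotated]) (auto simp: algebra_simps simp flip: mon_mult)
qed

lemma lead_prod:
  assumes "finite A" "\<And>a. a \<in> A \<Longrightarrow> lead I w (f a) (e a)"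
  shows "lead I w (\<lambda>x. \<Prod>a\<in>A. f a x) (\<lambda>v. \<Sum>a\<in>A. e a v)"
  using assms by (induction A rule: finite_induct) (auto intro: lead_1 lead_mult)

lemma lead_power: "lead I w f e \<Longrightarrow> lead I w (\<lambda>x. f x ^ k) (\<lambda>v. k * e v)"
  by (induction k) (auto intro: lead_1 lead_mult)

text \<open>Strict rearrangement inequality: the sum of the squared differences between i and its
  image is positive, and a permutation preserves the sum of squares.\<close>

lemma sum_mult_permutation_less:
  fixes S :: "nat set"
  assumes "finite S" "\<pi> permutes S" "\<pi> \<noteq> id"
  shows "(\<Sum>i\<in>S. int i * int (\<pi> i)) < (\<Sum>i\<in>S. int i * int i)"
proof -
  obtain j where j: "j \<in> S" "\<pi> j \<noteq> j"
    using assms by (metis eq_id_iff permutes_not_in)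
  have "0 < (\<Sum>i\<in>S. (int i - int (\<pi> i))\<^sup>2)"
    using assms(1) j by (intro sum_pos2[of _ j]) auto
  also have "\<dots> = (\<Sum>i\<in>S. int i * int i) + (\<Sum>i\<in>S. int (\<pi> i) * int (\<pi> i)) - 2 * (\<Sum>i\<in>S. int i * int (\<pi> i))"
    by (simp add: power2_eq_square algebra_simps sum.distrib sum_subtractf sum_distrib_left)
  also have "(\<Sum>i\<in>S. int (\<pi> i) * int (\<pi> i)) = (\<Sum>i\<in>S. int i * int i)"
    using sum.permute[OF assms(2), of "\<lambda>i. int i * int i"] by (simp add: comp_def)
  finally show ?thesis by simp
qed

text \<open>In the weight of the term of a permutation, the row terms \<alpha> and the column shift
  \<open>c\<close> contribute constants; only -2 times the sum of i * \<pi> i varies. By the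
  rearrangement inequality the identity is the unique minimum.\<close>

lemma lead_ldet:
  fixes S :: "nat set"
  assumes "finite I" "finite S" "\<And>i j. i \<in> S \<Longrightarrow> j \<in> S \<Longrightarrow> z i (\<kappa> j) \<in> I"
    and \<kappa>: "\<And>j. j \<in> S \<Longrightarrow> int (\<kappa> j) = int j + c"
    and w: "\<And>i a. w (z i a) = \<alpha> i - 2 * int i * int a"
  shows "lead I w (\<lambda>x. ldet S (\<lambda>i j. x (z i (\<kappa> j)))) (expo S (\<lambda>i. z i (\<kappa> i)))"
proof -
  let ?e = "\<lambda>\<pi>. expo S (\<lambda>i. z i (\<kappa> (\<pi> i)))"
  let ?P = "{\<pi>. \<pi> permutes S}"
  have sub: "(\<lambda>i. z i (\<kappa> (\<pi> i))) ` S \<subseteq> I" if "\<pi> permutes S" for \<pi>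
    using assms(3) that by (auto simp: permutes_in_image)
  have deg: "(\<Sum>v\<in>I. int (?e \<pi> v)) = int (card S)" if "\<pi> permutes S" for \<pi>
    using sum_expo[OF assms(1,2) sub[OF that], of "\<lambda>_. 1"] by simp
  have wt: "(\<Sum>v\<in>I. w v * int (?e \<pi> v)) =
      (\<Sum>i\<in>S. \<alpha> i - 2 * int i * c) - 2 * (\<Sum>i\<in>S. int i * int (\<pi> i))" if "\<pi> permutes S" for \<pi>
  proof -
    have "(\<Sum>v\<in>I. w v * int (?e \<pi> v)) = (\<Sum>i\<in>S. \<alpha> i - 2 * int i * (int (\<pi> i) + c))"
      unfolding sum_expo[OF assms(1,2) sub[OF that]] w
      by (intro sum.cong) (use that in \<open>auto simp: \<kappa> permutes_in_image\<close>)
    then show ?thesis by (simp add: algebra_simps sum.distrib sum_subtractf sum_distrib_left)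
  qed
  let ?R = "\<lambda>x. \<Sum>\<pi>\<in>?P - {id}. of_int (sign \<pi>) * mon I (?e \<pi>) x"
  have mem: "?R \<in> mspan I {e'. (\<Sum>v\<in>I. int (e' v)) = (\<Sum>v\<in>I. int (?e id v)) \<and>
      (\<Sum>v\<in>I. w v * int (e' v)) > (\<Sum>v\<in>I. w v * int (?e id v))}"
  proof (intro mspan_sum mspan_monomial CollectI conjI)
    fix \<pi> assume "\<pi> \<in> ?P - {id}"
    then have \<pi>: "\<pi> permutes S" "\<pi> \<noteq> id" by auto
    show "(\<Sum>v\<in>I. int (?e \<pi> v)) = (\<Sum>v\<in>I. int (?e id v))"
      using deg[OF \<pi>(1)] deg[OF permutes_id] by simp
    show "(\<Sum>v\<in>I. w v * int (?e \<pi> v)) > (\<Sum>v\<in>I. w v * int (?e id v))"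
      using wt[OF \<pi>(1)] wt[OF permutes_id] sum_mult_permutation_less[OF assms(2) \<pi>] by simp
  qed
  have eq: "ldet S (\<lambda>i j. x (z i (\<kappa> j))) = mon I (?e id) x + ?R x" for x
  proof -
    have "ldet S (\<lambda>i j. x (z i (\<kappa> j))) = (\<Sum>\<pi>\<in>?P. of_int (sign \<pi>) * mon I (?e \<pi>) x)"
      unfolding ldet_def by (intro sum.cong) (auto simp: mon_expo[OF assms(1,2) sub])
    also have "\<dots> = of_int (sign id) * mon I (?e id) x + ?R x"
      using finite_permutations[OF assms(2)] by (subst sum.remove[of ?P id]) (auto simp: permutes_id)
    finally show ?thesis by simp
  qed
  show ?thesis
    unfolding lead_def using mem eq by (auto simp: id_def intro!: bexI[of _ ?R] ext)
qed

lemma lead_bilinear: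
  assumes "finite I" "finite A" "i \<in> A" "\<And>j. j \<in> A \<Longrightarrow> u j \<in> I \<and> u' j \<in> I"
    and "\<And>j. j \<in> A \<Longrightarrow> j \<noteq> i \<Longrightarrow> w (u j) + w (u' j) > w (u i) + w (u' i)"
  shows "lead I w (\<lambda>x. \<Sum>j\<in>A. x (u j) * x (u' j))
    (\<lambda>v. (if u i = v then 1 else 0) + (if u' i = v then 1 else 0))"
proof -
  let ?e = "\<lambda>j v. (if u j = v then 1 else 0) + (if u' j = v then 1 else 0) :: nat"
  \<comment> \<open>Writing a product of two coordinates as a product over \<open>bool\<close> makes
    the general formulas for \<open>expo\<close> available.\<close>
  have e: "?e j v = expo (UNIV :: bool set) (\<lambda>b. if b then u j else u' j) v" for j v
    by (auto simp: expo_def UNIV_bool)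
  have sub: "(\<lambda>b. if b then u j else u' j) ` UNIV \<subseteq> I" if "j \<in> A" for j
    using assms(4)[OF that] by auto
  have m: "mon I (?e j) x = x (u j) * x (u' j)" if "j \<in> A" for j x
    unfolding e using mon_expo[OF assms(1) _ sub[OF that]] by (simp add: UNIV_bool mult.commute)
  have s: "(\<Sum>v\<in>I. f v * int (?e j v)) = f (u j) + f (u' j)" if "j \<in> A" for j and f :: "_ \<Rightarrow> int"
    unfolding e using sum_expo[OF assms(1) _ sub[OF that], of f] by (simp add: UNIV_bool)
  let ?R = "\<lambda>x. \<Sum>j\<in>A - {i}. 1 * mon I (?e j) x"
  have mem: "?R \<in> mspan I {e'. (\<Sum>v\<in>I. int (e' v)) = (\<Sum>v\<in>I. int (?e i v)) \<and>
      (\<Sum>v\<in>I. w v * int (e' v)) > (\<Sum>v\<in>I. w v * int (?e i v))}"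
  proof (intro mspan_sum mspan_monomial CollectI conjI)
    fix j assume j: "j \<in> A - {i}"
    show "(\<Sum>v\<in>I. int (?e j v)) = (\<Sum>v\<in>I. int (?e i v))"
      using s[of j "\<lambda>_. 1"] s[of i "\<lambda>_. 1"] j assms(3) by simp
    show "(\<Sum>v\<in>I. w v * int (?e j v)) > (\<Sum>v\<in>I. w v * int (?e i v))"
      using s[of j w] s[of i w] j assms(3,5) by simp
  qed
  have eq: "(\<Sum>j\<in>A. x (u j) * x (u' j)) = mon I (?e i) x + ?R x" for x
    by (subst sum.remove[OF assms(2,3)]) (auto simp: m assms(3) intro!: sum.cong)
  show ?thesis
    unfolding lead_def using mem eq by (auto simp: id_def intro!: bexI[of _ ?R] ext)
qed

context frobenius_trace
begin

text \<open>A remainder monomial with nonzero trace coefficient would have all exponents at least p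
  - 1. Equal total degree would make them all equal to p - 1, contradicting the strictly larger
  weight. So only the leading monomial contributes.\<close>

lemma D_lead:
  assumes "lead I w f e" "\<And>v. v \<in> I \<Longrightarrow> e v = p - 1"
  shows "D I f x = trace_coeff (\<lambda>v. p - 1)"
proof -
  let ?deg = "\<lambda>e. \<Sum>v\<in>I. int (e v)" and ?wt = "\<lambda>e. \<Sum>v\<in>I. w v * int (e v)"
  let ?t = "\<lambda>v :: 'i. p - 1"
  let ?E = "{e'. ?deg e' = ?deg ?t \<and> ?wt e' > ?wt ?t}"
  obtain R where R: "R \<in> mspan I ?E" "f = (\<lambda>x. mon I ?t x + R x)"
    using lead_cong[OF assms] unfolding lead_def by blast
  have "D I R = (\<lambda>x. 0)"
    using R(1)
  proof induction
    case zero
    show ?case using D_mon[of 0 "\<lambda>_. 0"] by simp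
  next
    case (step f e c)
    have "trace_coeff e = 0"
    proof (rule ccontr)
      assume "trace_coeff e \<noteq> 0"
      then have ge: "p - 1 \<le> e v" if "v \<in> I" for v
        using trace_coeff_nonzero[OF _ that] mod_less_eq_dividend[of "e v" p] by simp
      have "e v = p - 1" if "v \<in> I" for v
      proof (rule ccontr)
        assume "e v \<noteq> p - 1"
        then have "?deg ?t < ?deg e"
          using ge that by (intro sum_strict_mono_ex1 finite_I) (auto intro!: bexI[of _ v] simp: order.strict_iff_order)
        then show False using step.hyps by simp
      qed
      then have "?wt e = ?wt ?t" by (intro sum.cong) auto
      then show False using step.hyps by simp
    qed
    then show ?case
      using step D_mon[of c e]
      by (simp add: D_add finite_I Pol_mult Pol_const Pol_monomial mspan_Pol)
  qed
  moreover have "D I (mon I ?t) = (\<lambda>x. trace_coeff ?t)"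
    using D_mon[of 1 ?t] by (simp add: mon_def[abs_def])
  ultimately show ?thesis
    unfolding R(2) using mspan_Pol[OF R(1)] by (simp add: D_add finite_I Pol_monomial)
qed

end

section \<open>The splitting section\<close>

text \<open>\<open>X i a\<close> stands for the i-th coordinate of the a-th vector,
  \<open>Y i b\<close> for the i-th coordinate of the b-th covector in the dual basis, all counted
  from 0.\<close>

datatype coord = X nat nat | Y nat nat

definition coords :: "nat \<Rightarrow> nat \<Rightarrow> nat \<Rightarrow> coord set" where
  "coords n m q = case_prod X ` ({..<n} \<times> {..<m}) \<union> case_prod Y ` ({..<n} \<times> {..<q})"

lemma X_coords [simp]: "X i a \<in> coords n m q \<longleftrightarrow> i < n \<and> a < m"
  and Y_coords [simp]: "Y i a \<in> coords n m q \<longleftrightarrow> i < n \<and> a < q"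
  by (auto simp: coords_def)

lemma finite_coords [simp]: "finite (coords n m q)"
  by (simp add: coords_def)

text \<open>The matrix 1 + t E_ij acts on the vectors and its inverse transpose on the covectors,
  whence the exchange of \<open>i\<close> and \<open>j\<close> and the sign.\<close>

definition elem :: "nat \<Rightarrow> nat \<Rightarrow> 'k::comm_ring_1 \<Rightarrow> (coord \<Rightarrow> 'k) \<Rightarrow> coord \<Rightarrow> 'k" where
  "elem i j t x v = (case v of
      X r a \<Rightarrow> if r = i then x (X i a) + t * x (X j a) else x (X r a)
    | Y r b \<Rightarrow> if r = j then x (Y j b) - t * x (Y i b) else x (Y r b))"

definition torus :: "(nat \<Rightarrow> 'k::field) \<Rightarrow> (coord \<Rightarrow> 'k) \<Rightarrow> coord \<Rightarrow> 'k" where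
  "torus h x v = (case v of X r a \<Rightarrow> h r * x (X r a) | Y r b \<Rightarrow> inverse (h r) * x (Y r b))"

definition pairing :: "nat \<Rightarrow> nat \<Rightarrow> nat \<Rightarrow> (coord \<Rightarrow> 'k::comm_ring_1) \<Rightarrow> 'k" where
  "pairing n a b x = (\<Sum>i<n. x (X i a) * x (Y i b))"

definition top_right :: "nat \<Rightarrow> nat \<Rightarrow> (nat \<times> nat) set" where
  "top_right n m = {(i, a). i < n \<and> i + m - n < a \<and> a < m}"

text \<open>Here \<open>l - r\<close> runs through the first n - r columns, so the factors are the
  proper bottom-left corner minors. The corner r = 0 is the factor c = 0 of
  \<open>full_minors\<close>.\<close>

definition low_minors :: "(nat \<Rightarrow> nat \<Rightarrow> coord) \<Rightarrow> nat \<Rightarrow> (coord \<Rightarrow> 'k::comm_ring_1) \<Rightarrow> 'k" where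
  "low_minors z n x = (\<Prod>r\<in>{1..<n}. ldet {r..<n} (\<lambda>i l. x (z i (l - r))))"

definition full_minors :: "(nat \<Rightarrow> nat \<Rightarrow> coord) \<Rightarrow> nat \<Rightarrow> nat \<Rightarrow> (coord \<Rightarrow> 'k::comm_ring_1) \<Rightarrow> 'k" where
  "full_minors z n m x = (\<Prod>c\<le>m - n. ldet {..<n} (\<lambda>i l. x (z i (l + c))))"

text \<open>The diagonal terms of the low minors cover the coordinates with \<open>a < i\<close>, those of the full minors
  the band \<open>i \<le> a \<le> i + (m - n)\<close>, and each pairing covers one of the remaining coordinates of \<open>X\<close>
  together with one of the remaining coordinates of \<open>Y\<close>.\<close>

definition tau :: "nat \<Rightarrow> nat \<Rightarrow> nat \<Rightarrow> (coord \<Rightarrow> 'k::comm_ring_1) \<Rightarrow> 'k" where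
  "tau n m q x = low_minors X n x * full_minors X n m x * (low_minors Y n x * full_minors Y n q x) *
    (\<Prod>(i, a)\<in>top_right n m. pairing n a (i + (m + q - n) - a) x)"

lemma finite_top_right [simp]: "finite (top_right n m)"
  by (rule finite_subset[of _ "{..<n} \<times> {..<m}"]) (auto simp: top_right_def)

lemma low_minors_Pol:
  assumes "finite I" "\<And>i a. i < n \<Longrightarrow> a < n \<Longrightarrow> z i a \<in> I"
  shows "low_minors z n \<in> Pol I"
  unfolding low_minors_def[abs_def] by (intro Pol_prod ldet_Pol Pol_var assms) auto

lemma full_minors_Pol:
  assumes "finite I" "\<And>i a. i < n \<Longrightarrow> a < m \<Longrightarrow> z i a \<in> I" "n \<le> m"
  shows "full_minors z n m \<in> Pol I"
  unfolding full_minors_def[abs_def] by (intro Pol_prod ldet_Pol Pol_var assms) (use assms(3) in auto)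

lemma pairing_Pol: "a < m \<Longrightarrow> b < q \<Longrightarrow> pairing n a b \<in> Pol (coords n m q)"
  unfolding pairing_def[abs_def] by (intro Pol_sum Pol_mult Pol_var) auto

lemma low_minors_lead:
  assumes "finite I" "\<And>i a. i < n \<Longrightarrow> a < n \<Longrightarrow> z i a \<in> I"
    and "\<And>i a. w (z i a) = \<alpha> i - 2 * int i * int a"
  shows "lead I w (low_minors z n) (\<lambda>v. \<Sum>r\<in>{1..<n}. expo {r..<n} (\<lambda>i. z i (i - r)) v)"
  unfolding low_minors_def[abs_def]
proof (intro lead_prod)
  fix r
  show "lead I w (\<lambda>x. ldet {r..<n} (\<lambda>i l. x (z i (l - r)))) (expo {r..<n} (\<lambda>i. z i (i - r)))"
    by (rule lead_ldet[where c = "- int r" and \<alpha> = \<alpha> and \<kappa> = "\<lambda>l. l - r"]) (use assms in auto)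
qed simp

lemma full_minors_lead:
  assumes "finite I" "\<And>i a. i < n \<Longrightarrow> a < m \<Longrightarrow> z i a \<in> I" "n \<le> m"
    and "\<And>i a. w (z i a) = \<alpha> i - 2 * int i * int a"
  shows "lead I w (full_minors z n m) (\<lambda>v. \<Sum>c\<le>m - n. expo {..<n} (\<lambda>i. z i (i + c)) v)"
  unfolding full_minors_def[abs_def]
proof (intro lead_prod)
  fix c assume "c \<in> {..m - n}"
  then show "lead I w (\<lambda>x. ldet {..<n} (\<lambda>i l. x (z i (l + c)))) (expo {..<n} (\<lambda>i. z i (i + c)))"
    by (intro lead_ldet[where c = "int c" and \<alpha> = \<alpha> and \<kappa> = "\<lambda>l. l + c"]) (use assms in auto)
qed simp

text \<open>A cell with a < i lies on the diagonal of exactly one corner minor, the one with r = i -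
  a.\<close>

lemma low_exponent:
  fixes z :: "nat \<Rightarrow> nat \<Rightarrow> 'i"
  assumes "\<And>i a i' a'. z i a = z i' a' \<longleftrightarrow> i = i' \<and> a = a'" "i < n"
  shows "(\<Sum>r\<in>{1..<n}. expo {r..<n} (\<lambda>i. z i (i - r)) (z i a)) = (if a < i then 1 else 0)"
proof -
  have "expo {r..<n} (\<lambda>i. z i (i - r)) (z i a) = (if r = i - a then if a < i then 1 else 0 else 0)"
    if "r \<in> {1..<n}" for r
  proof -
    have "expo {r..<n} (\<lambda>i. z i (i - r)) (z i a) =
        (\<Sum>i'\<in>{r..<n}. if i' = i then if i - r = a then 1 else 0 else 0)"
      unfolding expo_def assms(1) by (intro sum.cong) auto
    also have "\<dots> = (if i \<in> {r..<n} then if i - r = a then 1 else 0 else 0)"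
      by (rule sum.delta) simp
    also have "\<dots> = (if r = i - a then if a < i then 1 else 0 else 0)"
      using assms(2) that by (cases "r \<le> i") auto
    finally show ?thesis .
  qed
  then show ?thesis using assms(2) by auto
qed

text \<open>The only full minor whose diagonal can pass through the cell is the one starting at
  column c = a - i.\<close>

lemma full_exponent:
  fixes z :: "nat \<Rightarrow> nat \<Rightarrow> 'i"
  assumes "\<And>i a i' a'. z i a = z i' a' \<longleftrightarrow> i = i' \<and> a = a'" "i < n"
  shows "(\<Sum>c\<le>m - n. expo {..<n} (\<lambda>i. z i (i + c)) (z i a)) = (if i \<le> a \<and> a \<le> i + (m - n) then 1 else 0)"
proof -
  have "expo {..<n} (\<lambda>i. z i (i + c)) (z i a) = (if c = a - i then if i \<le> a then 1 else 0 else 0)" for c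
  proof -
    have "expo {..<n} (\<lambda>i. z i (i + c)) (z i a) =
        (\<Sum>i'\<in>{..<n}. if i' = i then if i + c = a then 1 else 0 else 0)"
      unfolding expo_def assms(1) by (intro sum.cong) auto
    also have "\<dots> = (if i \<in> {..<n} then if i + c = a then 1 else 0 else 0)"
      by (rule sum.delta) simp
    also have "\<dots> = (if c = a - i then if i \<le> a then 1 else 0 else 0)"
      using assms(2) by (cases "i \<le> a") auto
    finally show ?thesis .
  qed
  then show ?thesis by auto
qed

lemma disjoint_exponent: "(\<And>i. u i \<noteq> v) \<Longrightarrow> expo A u v = 0"
  by (simp add: expo_def)

locale sl_coords = frobenius_trace "coords n m q" p k_type
  for n m q p :: nat and k_type :: "'k::alg_closed_field itself" +
  assumes nm: "n \<le> m" and nq: "n \<le> q"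
begin

abbreviation I :: "coord set" where "I \<equiv> coords n m q"
abbreviation \<tau> :: "(coord \<Rightarrow> 'k) \<Rightarrow> 'k" where "\<tau> \<equiv> tau n m q"

text \<open>With these weights the term \<open>i'\<close> of the pairing factor indexed by \<open>(i, a)\<close> has weight
  \<open>(i' - i)\<^sup>2 - i\<^sup>2\<close>, so the leading term is the one with \<open>i' = i\<close>.\<close>

definition weight :: "coord \<Rightarrow> int" where
  "weight v = (case v of X i a \<Rightarrow> int i * int i - 2 * int i * int a
    | Y i b \<Rightarrow> 2 * int i * int (m + q - n) - 2 * int i * int b)"

text \<open>In row \<open>i\<close> the reflection of a to i + (m + q - n) - a carries the columns
  of X to the right of the band to those of Y to the right of its band. The natural subtraction is
  exact there.\<close>

lemma partner_bounds:
  assumes "(i, a) \<in> top_right n m"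
  shows "i + (m + q - n) - a < q" "int (i + (m + q - n) - a) = int i + int (m + q - n) - int a"
  using assms nm nq by (auto simp: top_right_def)

lemma pairing_lead:
  assumes "(i, a) \<in> top_right n m"
  defines "b \<equiv> i + (m + q - n) - a"
  shows "lead I weight (pairing n a b) (\<lambda>v. (if X i a = v then 1 else 0) + (if Y i b = v then 1 else 0))"
  unfolding pairing_def[abs_def]
proof (rule lead_bilinear)
  show "X j a \<in> I \<and> Y j b \<in> I" if "j \<in> {..<n}" for j
    using assms that partner_bounds[OF assms(1)] by (auto simp: top_right_def)
  show "weight (X i a) + weight (Y i b) < weight (X j a) + weight (Y j b)" if "j \<noteq> i" for j
  proof -
    have "weight (X j a) + weight (Y j b) = (int j - int i)\<^sup>2 - (int i)\<^sup>2" for j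
      unfolding weight_def b_def coord.case partner_bounds(2)[OF assms(1)]
      by (simp add: power2_eq_square algebra_simps)
    then show ?thesis using that by simp
  qed
qed (use assms in \<open>auto simp: top_right_def\<close>)

lemma tau_lead: "lead I weight \<tau> (\<lambda>v. 1)"
proof -
  let ?low = "\<lambda>z v. \<Sum>r\<in>{1..<n}. expo {r..<n} (\<lambda>i. z i (i - r)) v"
  let ?full = "\<lambda>z m v. \<Sum>c\<le>m - n. expo {..<n} (\<lambda>i. z i (i + c)) v"
  let ?pr = "\<lambda>v. \<Sum>(i, a)\<in>top_right n m.
      (if X i a = v then 1 else 0) + (if Y i (i + (m + q - n) - a) = v then 1 else 0)"
  have wX: "weight (X i a) = int i * int i - 2 * int i * int a"
    and wY: "weight (Y i a) = 2 * int i * int (m + q - n) - 2 * int i * int a" for i a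
    by (simp_all add: weight_def)
  have "lead I weight (\<lambda>x. \<Prod>(i, a)\<in>top_right n m. pairing n a (i + (m + q - n) - a) x) ?pr"
    unfolding case_prod_unfold by (intro lead_prod pairing_lead) auto
  then have "lead I weight \<tau> (\<lambda>v. ?low X v + ?full X m v + (?low Y v + ?full Y q v) + ?pr v)"
    unfolding tau_def[abs_def]
    by (intro lead_mult low_minors_lead[OF _ _ wX] low_minors_lead[OF _ _ wY]
        full_minors_lead[OF _ _ _ wX] full_minors_lead[OF _ _ _ wY]) (use nm nq in auto)
  then show ?thesis
  proof (rule lead_cong)
    fix v assume v: "v \<in> I"
    show "?low X v + ?full X m v + (?low Y v + ?full Y q v) + ?pr v = 1"
    proof (cases v)
      case (X i a)
      then have ia: "i < n" "a < m" using v by auto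
      have "?pr (X i a) = (\<Sum>ja\<in>top_right n m. if ja = (i, a) then 1 else 0)"
        by (intro sum.cong) (auto split: if_splits)
      also have "\<dots> = (if (i, a) \<in> top_right n m then 1 else 0)" by simp
      finally have e1: "?pr (X i a) = (if i + (m - n) < a then 1 else 0)"
        using ia nm by (simp add: top_right_def)
      have e2: "?low X (X i a) = (if a < i then 1 else 0)"
        by (rule low_exponent) (use ia in auto)
      have e3: "?full X m (X i a) = (if i \<le> a \<and> a \<le> i + (m - n) then 1 else 0)"
        by (rule full_exponent) (use ia in auto)
      have e4: "?low Y (X i a) = 0" "?full Y q (X i a) = 0"
        by (simp_all add: disjoint_exponent)
      show ?thesis unfolding X e1 e2 e3 e4 by auto
    next
      case (Y i b)
      then have ib: "i < n" "b < q" using v by auto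
      \<comment> \<open>Only the pairing with a = i + (m + q - n) - b has \<open>Y i b\<close> in
        its leading term, and its index lies in \<open>top_right\<close> exactly when b > i + (q -
        n).\<close>
      have "?pr (Y i b) = (\<Sum>ja\<in>top_right n m. if ja = (i, i + (m + q - n) - b) then (if b > i + (q - n) then 1 else 0) else 0)"
        using ib nm nq by (intro sum.cong) (auto simp: top_right_def split: if_splits)
      also have "\<dots> = (if (i, i + (m + q - n) - b) \<in> top_right n m then if b > i + (q - n) then 1 else 0 else 0)"
        by (rule sum.delta) simp
      also have "\<dots> = (if b > i + (q - n) then 1 else 0)"
        using ib nm nq by (auto simp: top_right_def)
      finally have e1: "?pr (Y i b) = (if b > i + (q - n) then 1 else 0)" .
      have e2: "?low Y (Y i b) = (if b < i then 1 else 0)"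
        by (rule low_exponent) (use ib in auto)
      have e3: "?full Y q (Y i b) = (if i \<le> b \<and> b \<le> i + (q - n) then 1 else 0)"
        by (rule full_exponent) (use ib in auto)
      have e4: "?low X (Y i b) = 0" "?full X m (Y i b) = 0"
        by (simp_all add: disjoint_exponent)
      show ?thesis unfolding Y e1 e2 e3 e4 by auto
    qed
  qed
qed

lemma D_tau_power: "D I (\<lambda>x. \<tau> x ^ (p - 1)) x = trace_coeff (\<lambda>v. p - 1)"
  using D_lead[OF lead_power[OF tau_lead]] by simp

lemma tau_Pol: "\<tau> \<in> Pol I"
  using tau_lead by (rule lead_Pol)

end

section \<open>Elementary and diagonal transformations\<close>

lemma elem_X [simp]: "elem i j t x (X r a) = (if r = i then x (X i a) + t * x (X j a) else x (X r a))"
  and elem_Y [simp]: "elem i j t x (Y r b) = (if r = j then x (Y j b) - t * x (Y i b) else x (Y r b))"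
  by (simp_all add: elem_def)

lemma torus_X [simp]: "torus h x (X r a) = h r * x (X r a)"
  and torus_Y [simp]: "torus h x (Y r b) = inverse (h r) * x (Y r b)"
  by (simp_all add: torus_def)

lemma coord_fun_eqI:
  "(\<And>r a. x (X r a) = y (X r a)) \<Longrightarrow> (\<And>r a. x (Y r a) = y (Y r a)) \<Longrightarrow> x = (y :: coord \<Rightarrow> 'b)"
proof
  fix v assume "\<And>r a. x (X r a) = y (X r a)" "\<And>r a. x (Y r a) = y (Y r a)"
  then show "x v = y v" by (cases v) auto
qed

text \<open>The product of \<open>X j a\<close> and \<open>Y i b\<close>, multiplied by t, is gained
  in summand \<open>i\<close> and lost in summand \<open>j\<close>.\<close>

lemma pairing_elem:
  assumes "i < n" "j < n" "i \<noteq> j"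
  shows "pairing n a b (elem i j t x) = pairing n a b x"
proof -
  have "{..<n} = insert i (insert j ({..<n} - {i, j}))" using assms by auto
  then have "sum f {..<n} = f i + (f j + sum f ({..<n} - {i, j}))" for f :: "nat \<Rightarrow> 'a"
    using assms by (metis (no_types, lifting) DiffE finite_Diff finite_lessThan insertCI insertE sum.insert finite_insert)
  moreover have "(\<Sum>k\<in>{..<n} - {i, j}. elem i j t x (X k a) * elem i j t x (Y k b)) =
      (\<Sum>k\<in>{..<n} - {i, j}. x (X k a) * x (Y k b))"
    by (intro sum.cong) auto
  ultimately show ?thesis
    using assms unfolding pairing_def by (simp add: algebra_simps)
qed

lemma pairing_torus:
  assumes "\<And>i. i < n \<Longrightarrow> h i \<noteq> 0"
  shows "pairing n a b (torus h x) = pairing n a b x"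
  unfolding pairing_def by (intro sum.cong) (use assms in auto)

text \<open>When row \<open>i\<close> occurs in the minor, so does the row \<open>j\<close> that is
  added to it; otherwise no entry changes.\<close>

lemma ldet_X_elem:
  assumes "finite S" "i \<in> S \<Longrightarrow> j \<in> S" "i \<noteq> j"
  shows "ldet S (\<lambda>r l. elem i j t x (X r (\<kappa> l))) = ldet S (\<lambda>r l. x (X r (\<kappa> l)))"
proof (cases "i \<in> S")
  case True
  let ?M = "\<lambda>r l. x (X r (\<kappa> l))"
  have "(\<lambda>r l. elem i j t x (X r (\<kappa> l))) = ?M(i := \<lambda>l. ?M i l + t * ?M j l)"
    by (auto simp: fun_eq_iff)
  then show ?thesis using ldet_add_row[of S i j ?M t] assms True by simp
next
  case False
  then show ?thesis by (intro ldet_cong) auto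
qed

lemma ldet_Y_elem:
  assumes "finite S" "j \<in> S \<Longrightarrow> i \<in> S" "i \<noteq> j"
  shows "ldet S (\<lambda>r l. elem i j t x (Y r (\<kappa> l))) = ldet S (\<lambda>r l. x (Y r (\<kappa> l)))"
proof (cases "j \<in> S")
  case True
  let ?M = "\<lambda>r l. x (Y r (\<kappa> l))"
  have "(\<lambda>r l. elem i j t x (Y r (\<kappa> l))) = ?M(j := \<lambda>l. ?M j l + (- t) * ?M i l)"
    by (auto simp: fun_eq_iff)
  then show ?thesis using ldet_add_row[of S j i ?M "- t"] assms True by simp
next
  case False
  then show ?thesis by (intro ldet_cong) auto
qed

text \<open>The only factor that changes under a simple positive root is the minor of \<open>Y\<close> whose first row
  is the one being modified, and that minor changes linearly.\<close>

lemma low_minors_Y_elem: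
  assumes "Suc i < n"
  shows "low_minors Y n (elem i (Suc i) t x) = low_minors Y n x +
    t * (- ldet {Suc i..<n} (\<lambda>r l. x (Y (if r = Suc i then i else r) (l - Suc i))) *
      (\<Prod>r\<in>{1..<n} - {Suc i}. ldet {r..<n} (\<lambda>r' l. x (Y r' (l - r)))))"
proof -
  let ?x = "elem i (Suc i) t x"
  let ?S = "{Suc i..<n}" and ?M = "\<lambda>r l. x (Y r (l - Suc i))"
  let ?f = "\<lambda>x r. ldet {r..<n} (\<lambda>r' l. x (Y r' (l - r)))"
  have other: "?f ?x r = ?f x r" if "r \<noteq> Suc i" for r
    by (rule ldet_Y_elem) (use that in auto)
  have "(\<lambda>r l. ?x (Y r (l - Suc i))) = ?M(Suc i := \<lambda>l. ?M (Suc i) l + (- t) * ?M i l)"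
    by (auto simp: fun_eq_iff)
  moreover have "?M(Suc i := ?M i) = (\<lambda>r l. x (Y (if r = Suc i then i else r) (l - Suc i)))"
    by (auto simp: fun_eq_iff)
  ultimately have A: "?f ?x (Suc i) = ?f x (Suc i) +
      (- t) * ldet ?S (\<lambda>r l. x (Y (if r = Suc i then i else r) (l - Suc i)))"
    using ldet_row_linear[of ?S "Suc i" ?M "- t" "?M i"] assms by simp
  have B: "low_minors Y n z = ?f z (Suc i) * (\<Prod>r\<in>{1..<n} - {Suc i}. ?f z r)" for z
    unfolding low_minors_def using assms by (intro prod.remove) auto
  have C: "(\<Prod>r\<in>{1..<n} - {Suc i}. ?f ?x r) = (\<Prod>r\<in>{1..<n} - {Suc i}. ?f x r)"
    by (intro prod.cong) (use other in auto)
  show ?thesis unfolding B A C by (simp add: algebra_simps)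
qed

text \<open>The row sets of the minors of X are closed under passing from i to \<open>Suc i\<close>,
  the full minors of Y contain all rows, and pairings are invariant. Only one low minor of Y varies.
  The witness is \<open>tau\<close> with \<open>low_minors Y\<close> replaced by its coefficient of
  t.\<close>

lemma tau_elem:
  assumes "Suc i < n" "n \<le> m" "n \<le> q"
  obtains g where "g \<in> Pol (coords n m q)" "\<And>t x. tau n m q (elem i (Suc i) t x) = tau n m q x + t * g x"
proof
  let ?h = "\<lambda>x. - ldet {Suc i..<n} (\<lambda>r l. x (Y (if r = Suc i then i else r) (l - Suc i))) *
      (\<Prod>r\<in>{1..<n} - {Suc i}. ldet {r..<n} (\<lambda>r' l. x (Y r' (l - r))))"
  let ?g = "\<lambda>x. low_minors X n x * full_minors X n m x * (?h x * full_minors Y n q x) *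
    (\<Prod>(i, a)\<in>top_right n m. pairing n a (i + (m + q - n) - a) x)"
  have "(\<lambda>x. (- 1) * ldet {Suc i..<n} (\<lambda>r l. x (Y (if r = Suc i then i else r) (l - Suc i))) *
      (\<Prod>r\<in>{1..<n} - {Suc i}. ldet {r..<n} (\<lambda>r' l. x (Y r' (l - r))))) \<in> Pol (coords n m q)"
    using assms by (intro Pol_mult Pol_prod Pol_const ldet_Pol Pol_var) auto
  then have h: "?h \<in> Pol (coords n m q)" by simp
  have "(\<lambda>x. \<Prod>(i, a)\<in>top_right n m. pairing n a (i + (m + q - n) - a) x) \<in> Pol (coords n m q)"
    unfolding case_prod_unfold
    by (intro Pol_prod pairing_Pol) (use assms in \<open>auto simp: top_right_def\<close>)
  moreover have "low_minors X n \<in> Pol (coords n m q)" "full_minors X n m \<in> Pol (coords n m q)"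
    "full_minors Y n q \<in> Pol (coords n m q)"
    using assms by (auto intro!: low_minors_Pol full_minors_Pol)
  ultimately show "?g \<in> Pol (coords n m q)"
    using Pol_mult[OF Pol_mult[OF Pol_mult Pol_mult[OF h]]] by blast
  fix t x
  let ?x = "elem i (Suc i) t x"
  have "low_minors X n ?x = low_minors X n x"
    unfolding low_minors_def by (intro prod.cong refl ldet_X_elem) (use assms in auto)
  moreover have "full_minors X n m ?x = full_minors X n m x"
    unfolding full_minors_def by (intro prod.cong refl ldet_X_elem) (use assms in auto)
  moreover have "full_minors Y n q ?x = full_minors Y n q x"
    unfolding full_minors_def by (intro prod.cong refl ldet_Y_elem) (use assms in auto)
  moreover have "pairing n a b ?x = pairing n a b x" for a b
    by (rule pairing_elem) (use assms in auto)
  ultimately show "tau n m q ?x = tau n m q x + t * ?g x"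
    unfolding tau_def low_minors_Y_elem[OF assms(1)] by (simp add: algebra_simps)
qed

text \<open>Corner minors of X and Y on the same rows scale by inverse factors, full minors by the
  determinant or its inverse, which is 1, and pairings are unchanged.\<close>

lemma tau_torus:
  assumes "\<And>i. i < n \<Longrightarrow> h i \<noteq> (0 :: 'k::field)" "(\<Prod>i<n. h i) = 1"
  shows "tau n m q (torus h x) = tau n m q x"
proof -
  have X: "ldet S (\<lambda>r l. torus h x (X r (\<kappa> l))) = (\<Prod>r\<in>S. h r) * ldet S (\<lambda>r l. x (X r (\<kappa> l)))"
    and Y: "ldet S (\<lambda>r l. torus h x (Y r (\<kappa> l))) = inverse (\<Prod>r\<in>S. h r) * ldet S (\<lambda>r l. x (Y r (\<kappa> l)))"
    for S \<kappa>
    by (simp_all add: ldet_scale_rows comp_def flip: prod_inversef)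
  have nz: "(\<Prod>r\<in>{r'..<n}. h r) \<noteq> 0" for r'
    using assms(1) by simp
  have "low_minors X n (torus h x) * low_minors Y n (torus h x) = low_minors X n x * low_minors Y n x"
    unfolding low_minors_def X Y prod.distrib[symmetric]
    by (intro prod.cong) (use nz in \<open>auto simp: field_simps\<close>)
  moreover have "full_minors X n m (torus h x) = full_minors X n m x"
    "full_minors Y n q (torus h x) = full_minors Y n q x"
    unfolding full_minors_def X Y using assms(2) by simp_all
  moreover have "pairing n a b (torus h x) = pairing n a b x" for a b
    by (rule pairing_torus) (use assms in auto)
  moreover have "tau n m q z = (low_minors X n z * low_minors Y n z) * (full_minors X n m z * full_minors Y n q z) *
      (\<Prod>(i, a)\<in>top_right n m. pairing n a (i + (m + q - n) - a) z)" for z :: "coord \<Rightarrow> 'k"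
    by (simp add: tau_def mult_ac)
  ultimately show ?thesis by (simp add: case_prod_unfold)
qed

section \<open>Relations between root subgroups and the simple coroots\<close>

definition cotorus :: "nat \<Rightarrow> 'k::field \<Rightarrow> nat \<Rightarrow> 'k" where
  "cotorus i s r = (if r = i then s else if r = Suc i then inverse s else 1)"

lemma prod_cotorus:
  assumes "Suc i < n" "s \<noteq> 0"
  shows "(\<Prod>r<n. cotorus i s r) = 1"
proof -
  have "(\<Prod>r\<in>{..<n} - {i} - {Suc i}. cotorus i s r) = 1"
    by (intro prod.neutral) (auto simp: cotorus_def)
  then have "(\<Prod>r<n. cotorus i s r) = cotorus i s i * (cotorus i s (Suc i) * 1)"
    using assms by (subst prod.remove[of _ i], simp, simp, subst prod.remove[of _ "Suc i"]) auto
  then show ?thesis using assms by (simp add: cotorus_def)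
qed

text \<open>With u and v the upper and lower root subgroups and w(s) = u(s) v(-1/s) u(s), this is
  the identity that the coroot at s equals w(s) w(-1).\<close>

lemma torus_elem_decomposition:
  assumes "s \<noteq> 0"
  shows "torus (cotorus i s) x = elem i (Suc i) s (elem (Suc i) i (- inverse s) (elem i (Suc i) s
    (elem i (Suc i) (- 1) (elem (Suc i) i 1 (elem i (Suc i) (- 1) x)))))"
  by (rule coord_fun_eqI) (use assms in \<open>auto simp: cotorus_def field_simps\<close>)

text \<open>Bruhat decomposition of a lower unipotent element. On the right t enters only through
  1/t, and a function invariant under the upper root subgroup and the torus does not see the two
  leftmost factors.\<close>

lemma lower_elem_decomposition:
  assumes "t \<noteq> 0"
  shows "elem (Suc i) i t x = elem i (Suc i) (inverse t) (torus (cotorus i (inverse t))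
    (elem i (Suc i) (- 1) (elem (Suc i) i 1 (elem i (Suc i) (- 1) (elem i (Suc i) (inverse t) x)))))"
  by (rule coord_fun_eqI) (use assms in \<open>auto simp: cotorus_def field_simps\<close>)

text \<open>Commutator relation of root subgroups; it reaches arbitrary index pairs from adjacent
  ones.\<close>

lemma elem_commutator:
  assumes "i \<noteq> j" "j \<noteq> k" "i \<noteq> k"
  shows "elem i k t x = elem i j t (elem j k 1 (elem i j (- t) (elem j k (- 1) x)))"
  by (rule coord_fun_eqI) (use assms in \<open>auto simp: algebra_simps\<close>)

text \<open>Multiplying by t to the power \<open>degree Q\<close> turns the right-hand side into the
  reflected polynomial of Q, of degree at most \<open>degree Q\<close>, which leaves degree 0 for
  P.\<close>

lemma poly_in_t_and_inverse:
  fixes P Q :: "'k::field poly"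
  assumes "infinite (UNIV :: 'k set)" "\<And>t. t \<noteq> 0 \<Longrightarrow> poly P t = poly Q (inverse t)"
  shows "degree P = 0"
proof (cases "P = 0")
  case False
  have "infinite (UNIV - {0 :: 'k})" using assms(1) by simp
  then have "monom 1 (degree Q) * P = reflect_poly Q"
    by (rule poly_eqI_infinite)
       (auto simp: poly_monom assms(2) poly_reflect_poly_nz)
  then have "degree (monom (1 :: 'k) (degree Q) * P) \<le> degree Q"
    by (metis degree_reflect_poly_le)
  then show ?thesis
    using False by (simp add: degree_mult_eq degree_monom_eq monom_eq_0_iff)
qed simp

section \<open>The twisted trace\<close>

context frobenius_trace
begin

lemma D_sum:
  assumes "finite J" "\<And>a. a \<in> A \<Longrightarrow> f a \<in> Pol I"
  shows "D J (\<lambda>x. \<Sum>a\<in>A. f a x) = (\<lambda>x. \<Sum>a\<in>A. D J (f a) x)"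
proof -
  have "D J (\<lambda>x. 0) = (\<lambda>x. 0)"
    using D_cmult[OF assms(1) Pol_const, of 0 0] by simp
  with assms(2) show ?thesis
    by (induction A rule: infinite_finite_induct) (simp_all add: D_add assms(1) Pol_sum)
qed

end

context sl_coords
begin

lemma elem_coord_Pol: "i < n \<Longrightarrow> j < n \<Longrightarrow> v \<in> I \<Longrightarrow> (\<lambda>x. elem i j t x v) \<in> Pol I"
proof (cases v)
  case (X r a)
  moreover assume "i < n" "j < n" "v \<in> I"
  ultimately show ?thesis
    by (cases "r = i") (auto intro!: Pol_add Pol_mult Pol_var Pol_const)
next
  case (Y r b)
  moreover assume "i < n" "j < n" "v \<in> I"
  ultimately show ?thesis
    by (cases "r = j") (auto intro!: Pol_diff Pol_mult Pol_var Pol_const)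
qed

lemma elem_Pol:
  assumes "i < n" "j < n" "f \<in> Pol I"
  shows "(\<lambda>x. f (elem i j t x)) \<in> Pol I"
  by (rule Pol_compose[OF finite_I assms(3) elem_coord_Pol]) (use assms in auto)

lemma elem_curve:
  assumes "f \<in> Pol I"
  shows "\<exists>P. \<forall>t. f (elem i j t x) = poly P t"
proof (rule Pol_curve[OF finite_I assms])
  fix v
  show "\<exists>P. \<forall>t. elem i j t x v = poly P t"
  proof (cases v)
    case (X r a)
    then show ?thesis
      by (cases "r = i") (auto intro: exI[of _ "[:x (X i a), x (X j a):]"] exI[of _ "[:x (X r a):]"])
  next
    case (Y r b)
    then show ?thesis
      by (cases "r = j") (auto intro: exI[of _ "[:x (Y j b), - x (Y i b):]"] exI[of _ "[:x (Y r b):]"])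
  qed
qed

lemma D_elem:
  assumes "Suc i < n" "f \<in> Pol I"
  shows "D I (\<lambda>x. f (elem i (Suc i) t x)) x = D I f (elem i (Suc i) t x)"
proof -
  \<comment> \<open>\<open>S\<close> collects the altered entries, row i of X and row
    \<open>Suc i\<close> of Y; \<open>s\<close> sends each to the entry added to it, and
    \<open>u\<close> is the coefficient.\<close>
  define S where "S = X i ` {..<m} \<union> Y (Suc i) ` {..<q}"
  define s where "s v = (case v of X r a \<Rightarrow> X (Suc r) a | Y r b \<Rightarrow> Y (r - 1) b)" for v
  define u :: "coord \<Rightarrow> 'k" where "u v = (case v of X r a \<Rightarrow> t | Y r b \<Rightarrow> - t)" for v
  let ?A = "\<lambda>x v. if v \<in> S then x v + u v * x (s v) else x v"
  have A: "?A x v = elem i (Suc i) t x v" if "v \<in> I" for x v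
    using that by (cases v) (auto simp: S_def s_def u_def)
  \<comment> \<open>The shear and \<open>elem\<close> agree on \<open>I\<close> only, which suffices
    for functions in \<open>Pol I\<close>.\<close>
  have eq: "g (?A x) = g (elem i (Suc i) t x)" if "g \<in> Pol I" for g x
    by (rule Pol_cong[OF that A])
  have "D I (\<lambda>x. f (?A x)) = (\<lambda>x. D I f (?A x))"
    by (rule D_shears) (use assms in \<open>auto simp: S_def s_def\<close>)
  then show ?thesis
    using assms(2) by (auto simp: eq D_Pol finite_I dest: fun_cong[of _ _ x])
qed

definition twisted_trace :: "((coord \<Rightarrow> 'k) \<Rightarrow> 'k) \<Rightarrow> (coord \<Rightarrow> 'k) \<Rightarrow> 'k" where
  "twisted_trace f = Tr (\<lambda>x. \<tau> x ^ (p - 1) * f x)"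

lemma twisted_trace_Pol: "f \<in> Pol I \<Longrightarrow> twisted_trace f \<in> Pol I"
  unfolding twisted_trace_def by (intro Tr_Pol Pol_mult Pol_power tau_Pol)

text \<open>Along a simple positive root subgroup \<open>\<tau>\<close> has degree at most one in the parameter, so the
  \<open>p\<close>-th power of the twisted trace has degree less than \<open>p\<close>, which makes the trace constant.\<close>

lemma twisted_trace_elem_upper:
  assumes i: "Suc i < n" and f: "f \<in> Pol I" and inv: "\<And>t x. f (elem i (Suc i) t x) = f x"
  shows "twisted_trace f (elem i (Suc i) t x) = twisted_trace f x"
proof -
  obtain g where g: "g \<in> Pol I" "\<And>t x. \<tau> (elem i (Suc i) t x) = \<tau> x + t * g x"
    using tau_elem[OF i nm nq] by blast
  obtain Q where Q: "\<And>t. twisted_trace f (elem i (Suc i) t x) = poly Q t"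
    using elem_curve[OF twisted_trace_Pol[OF f]] by blast
  \<comment> \<open>The coefficient of t^k in the p-th power of the trace, from the binomial
    expansion of (\<tau> + t g)^(p - 1).\<close>
  define c where "c k = D I (\<lambda>x. of_nat ((p - 1) choose k) * (g x ^ k * \<tau> x ^ (p - 1 - k) * f x)) x" for k
  have Pk: "(\<lambda>x. of_nat ((p - 1) choose k) * (g x ^ k * \<tau> x ^ (p - 1 - k) * f x)) \<in> Pol I" for k
    by (intro Pol_mult Pol_const Pol_power tau_Pol f g(1))
  have "poly (Q ^ p) t = poly (\<Sum>k\<le>p - 1. monom (c k) k) t" for t
  proof -
    have "poly (Q ^ p) t = D I (\<lambda>x. \<tau> x ^ (p - 1) * f x) (elem i (Suc i) t x)"
      by (simp add: Q[symmetric] twisted_trace_def Tr_pth_power)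
    also have "\<dots> = D I (\<lambda>x. \<tau> (elem i (Suc i) t x) ^ (p - 1) * f (elem i (Suc i) t x)) x"
      by (rule D_elem[symmetric, OF i]) (intro Pol_mult Pol_power tau_Pol f)
    also have "(\<lambda>x. \<tau> (elem i (Suc i) t x) ^ (p - 1) * f (elem i (Suc i) t x)) =
        (\<lambda>x. \<Sum>k\<le>p - 1. t ^ k * (of_nat ((p - 1) choose k) * (g x ^ k * \<tau> x ^ (p - 1 - k) * f x)))"
      by (simp add: g(2) inv add.commute[of "\<tau> _"] binomial_ring power_mult_distrib sum_distrib_left
          sum_distrib_right mult_ac)
    also have "D I \<dots> x = (\<Sum>k\<le>p - 1. t ^ k * c k)"
      unfolding c_def
      by (subst D_sum[OF finite_I Pol_mult[OF Pol_const Pk]]) (simp only: D_cmult[OF finite_I Pk])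
    finally show ?thesis by (simp add: poly_sum poly_monom mult.commute)
  qed
  then have "Q ^ p = (\<Sum>k\<le>p - 1. monom (c k) k)"
    by (rule poly_eqI_alg_closed)
  also have "degree \<dots> \<le> p - 1"
    by (intro degree_sum_le) (auto intro: order_trans[OF degree_monom_le])
  finally have "degree Q * p \<le> p - 1"
    by (cases "Q = 0") (simp_all add: degree_power_eq mult.commute)
  then have "degree Q = 0"
    using p_pos by (cases "degree Q") auto
  then obtain b where "Q = [:b:]" by (rule degree_eq_zeroE)
  moreover have "elem i (Suc i) 0 x = x"
    by (rule coord_fun_eqI) auto
  ultimately show ?thesis
    using Q[of t] Q[of 0] by simp
qed

text \<open>The scaling factors multiply to det^m on the vectors and det^(-q) on the covectors,
  hence to 1, so \<open>D I\<close> commutes with the substitution.\<close>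

lemma twisted_trace_torus:
  assumes h: "\<And>i. i < n \<Longrightarrow> h i \<noteq> 0" "(\<Prod>i<n. h i) = 1"
    and f: "f \<in> Pol I" and inv: "\<And>x. f (torus h x) = f x"
  shows "twisted_trace f (torus h x) = twisted_trace f x"
proof -
  define s where "s v = (case v of X r a \<Rightarrow> h r | Y r b \<Rightarrow> inverse (h r))" for v
  have s: "torus h x = (\<lambda>v. s v * x v)" for x
    by (auto simp: torus_def s_def fun_eq_iff split: coord.splits)
  have "(\<Prod>v\<in>I. s v) = (\<Prod>v\<in>case_prod X ` ({..<n} \<times> {..<m}). s v) * (\<Prod>v\<in>case_prod Y ` ({..<n} \<times> {..<q}). s v)"
    unfolding coords_def by (rule prod.union_disjoint) auto
  also have "(\<Prod>v\<in>case_prod X ` ({..<n} \<times> {..<m}). s v) = (\<Prod>(i, a)\<in>{..<n} \<times> {..<m}. h i)"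
    by (subst prod.reindex) (auto simp: inj_on_def s_def intro!: prod.cong)
  also have "\<dots> = 1"
    unfolding prod.cartesian_product[symmetric] by (simp add: prod_power_distrib[symmetric] h(2))
  also have "(\<Prod>v\<in>case_prod Y ` ({..<n} \<times> {..<q}). s v) = (\<Prod>(i, a)\<in>{..<n} \<times> {..<q}. inverse (h i))"
    by (subst prod.reindex) (auto simp: inj_on_def s_def intro!: prod.cong)
  also have "\<dots> = 1"
    unfolding prod.cartesian_product[symmetric]
    using prod_inversef[of h "{..<n}"] by (simp add: prod_power_distrib[symmetric] h(2) comp_def)
  finally have s1: "(\<Prod>v\<in>I. s v ^ (p - 1)) = 1"
    by (simp add: prod_power_distrib[symmetric])
  have Pol: "(\<lambda>x. \<tau> x ^ (p - 1) * f x) \<in> Pol I"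
    by (intro Pol_mult Pol_power tau_Pol f)
  have "twisted_trace f (torus h x) ^ p = D I (\<lambda>x. \<tau> x ^ (p - 1) * f x) (torus h x)"
    by (simp add: twisted_trace_def Tr_pth_power)
  also have "\<dots> = D I (\<lambda>x. \<tau> (torus h x) ^ (p - 1) * f (torus h x)) x"
    by (simp only: s D_scale[OF Pol, of s] s1 mult_1_left)
  also have "\<dots> = twisted_trace f x ^ p"
    by (simp add: twisted_trace_def Tr_pth_power tau_torus[OF h] inv)
  finally show ?thesis by (rule frobenius_inj)
qed

text \<open>Along the lower root subgroup \<open>f\<close> is a polynomial in t. The Bruhat
  decomposition and the two invariances make it, for t nonzero, a polynomial in 1/t as well.\<close>

lemma invariant_lower_elem:
  fixes f :: "(coord \<Rightarrow> 'k) \<Rightarrow> 'k"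
  assumes i: "Suc i < n" and f: "f \<in> Pol I"
    and up: "\<And>t x. f (elem i (Suc i) t x) = f x"
    and tor: "\<And>s x. s \<noteq> 0 \<Longrightarrow> f (torus (cotorus i s) x) = f x"
  shows "f (elem (Suc i) i t x) = f x"
proof -
  obtain P where P: "\<And>t. f (elem (Suc i) i t x) = poly P t"
    using elem_curve[OF f] by blast
  \<comment> \<open>What remains of the decomposition once the leftmost upper and torus factors are
    absorbed; it is then evaluated along the upper root subgroup at 1/t.\<close>
  let ?f = "\<lambda>x. f (elem i (Suc i) (- 1) (elem (Suc i) i 1 (elem i (Suc i) (- 1) x)))"
  have "?f \<in> Pol I"
    by (rule elem_Pol[of _ _ "\<lambda>x. f (elem i (Suc i) (- 1) (elem (Suc i) i 1 x))"],
        simp_all add: i Suc_lessD,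
        rule elem_Pol[of _ _ "\<lambda>x. f (elem i (Suc i) (- 1) x)"], simp_all add: i Suc_lessD,
        rule elem_Pol) (use i f in auto)
  then obtain Q where Q: "\<And>t. ?f (elem i (Suc i) t x) = poly Q t"
    using elem_curve by blast
  have "poly P t = poly Q (inverse t)" if "t \<noteq> 0" for t
    using that by (simp only: P[symmetric] Q[symmetric] lower_elem_decomposition[OF that])
      (simp only: up tor nonzero_imp_inverse_nonzero not_False_eq_True)
  then have "degree P = 0"
    using poly_in_t_and_inverse[OF infinite_UNIV_alg_closed, of P Q] by blast
  then obtain b where "P = [:b:]" by (rule degree_eq_zeroE)
  moreover have "elem (Suc i) i 0 x = x"
    by (rule coord_fun_eqI) auto
  ultimately show ?thesis
    using P[of t] P[of 0] by simp
qed

end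

text \<open>Induction on the distance between \<open>i\<close> and \<open>j\<close>, by the
  commutator whose middle index is the successor of the smaller one.\<close>

lemma invariant_elem_if_adjacent:
  assumes up: "\<And>i t x. Suc i < n \<Longrightarrow> f (elem i (Suc i) t x) = f x"
    and low: "\<And>i t x. Suc i < n \<Longrightarrow> f (elem (Suc i) i t x) = f x"
    and ij: "i < n" "j < n" "i \<noteq> j"
  shows "f (elem i j t x) = f x"
proof -
  have upper: "f (elem i (Suc (i + k)) t x) = f x" if "Suc (i + k) < n" for i k t x
    using that
  proof (induction k arbitrary: i t x)
    case (Suc k)
    have "f (elem (Suc i) (Suc (Suc i + k)) t x) = f x" for t x
      by (rule Suc.IH) (use Suc.prems in simp)
    then show ?case
      using elem_commutator[of i "Suc i" "Suc (i + Suc k)" t x] Suc.prems by (simp add: up)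
  qed (simp add: up)
  have lower: "f (elem (Suc (i + k)) i t x) = f x" if "Suc (i + k) < n" for i k t x
    using that
  proof (induction k arbitrary: i t x)
    case (Suc k)
    have "f (elem (Suc (Suc i + k)) (Suc i) t x) = f x" for t x
      by (rule Suc.IH) (use Suc.prems in simp)
    then show ?case
      using elem_commutator[of "Suc (i + Suc k)" "Suc i" i t x] Suc.prems by (simp add: low)
  qed (simp add: low)
  show ?thesis
  proof (cases "i < j")
    case True
    then show ?thesis using upper[of i "j - Suc i" t x] ij by simp
  next
    case False
    then show ?thesis using lower[of j "i - Suc j" t x] ij by simp
  qed
qed

context sl_coords
begin

lemma twisted_trace_elem:
  assumes f: "f \<in> Pol I" and inv: "\<And>i j t x. i < n \<Longrightarrow> j < n \<Longrightarrow> i \<noteq> j \<Longrightarrow> f (elem i j t x) = f x"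
    and ij: "i < n" "j < n" "i \<noteq> j"
  shows "twisted_trace f (elem i j t x) = twisted_trace f x"
proof (rule invariant_elem_if_adjacent[OF _ _ ij])
  fix i t x assume i: "Suc i < n"
  have up: "twisted_trace f (elem i (Suc i) t x) = twisted_trace f x" for t x
    by (rule twisted_trace_elem_upper[OF i f]) (use inv i in auto)
  have tor: "twisted_trace f (torus (cotorus i s) x) = twisted_trace f x" if "s \<noteq> 0" for s x
  proof (rule twisted_trace_torus[OF _ prod_cotorus[OF i that] f])
    show "cotorus i s r \<noteq> 0" for r
      using that by (simp add: cotorus_def)
    \<comment> \<open>Torus invariance of \<open>f\<close> is inherited from the elementary matrices
      of which the coroot is a product.\<close>
    show "f (torus (cotorus i s) x) = f x" for x
      unfolding torus_elem_decomposition[OF that] using i by (simp add: inv)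
  qed
  show "twisted_trace f (elem i (Suc i) t x) = twisted_trace f x" by (rule up)
  show "twisted_trace f (elem (Suc i) i t x) = twisted_trace f x"
    by (rule invariant_lower_elem[OF i twisted_trace_Pol[OF f] up tor])
qed

lemma twisted_trace_1:
  obtains c where "c \<noteq> 0" "\<And>x. twisted_trace (\<lambda>x. 1) x = c"
proof -
  obtain c where c: "c ^ p = trace_coeff (\<lambda>v. p - 1)"
    using pth_root_exists[OF p_pos] .
  then have "twisted_trace (\<lambda>x. 1) x = c" for x
    unfolding twisted_trace_def by (intro Tr_eqI) (simp only: D_tau_power mult_1_right)
  moreover have "c \<noteq> 0"
    using c trace_coeff_top p_pos by (auto simp: zero_power)
  ultimately show ?thesis using that by blast
qed

lemma coordinate_splitting:
  obtains \<Phi> :: "((coord \<Rightarrow> 'k) \<Rightarrow> 'k) \<Rightarrow> (coord \<Rightarrow> 'k) \<Rightarrow> 'k" where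
    "\<And>f. f \<in> Pol I \<Longrightarrow> \<Phi> f \<in> Pol I"
    "\<And>f g x. f \<in> Pol I \<Longrightarrow> g \<in> Pol I \<Longrightarrow> \<Phi> (\<lambda>x. f x + g x) x = \<Phi> f x + \<Phi> g x"
    "\<And>f g x. f \<in> Pol I \<Longrightarrow> g \<in> Pol I \<Longrightarrow> \<Phi> (\<lambda>x. f x ^ p * g x) x = f x * \<Phi> g x"
    "\<And>x. \<Phi> (\<lambda>x. 1) x = 1"
    "\<And>f i j t x. f \<in> Pol I \<Longrightarrow>
      (\<And>i j t x. i < n \<Longrightarrow> j < n \<Longrightarrow> i \<noteq> j \<Longrightarrow> f (elem i j t x) = f x) \<Longrightarrow>
      i < n \<Longrightarrow> j < n \<Longrightarrow> i \<noteq> j \<Longrightarrow> \<Phi> f (elem i j t x) = \<Phi> f x"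
proof -
  obtain c where c: "c \<noteq> 0" "\<And>x. twisted_trace (\<lambda>x. 1) x = c"
    using twisted_trace_1 by blast
  \<comment> \<open>Dividing by the nonzero constant \<open>c\<close> normalises the value at 1 and
    preserves the other properties.\<close>
  let ?\<Phi> = "\<lambda>f x. inverse c * twisted_trace f x"
  have \<tau>: "(\<lambda>x. \<tau> x ^ (p - 1) * f x) \<in> Pol I" if "f \<in> Pol I" for f
    by (intro Pol_mult Pol_power tau_Pol that)
  show ?thesis
  proof (rule that[of ?\<Phi>])
    show "?\<Phi> f \<in> Pol I" if "f \<in> Pol I" for f
      by (intro Pol_mult Pol_const twisted_trace_Pol that)
    show "?\<Phi> (\<lambda>x. f x + g x) x = ?\<Phi> f x + ?\<Phi> g x" if "f \<in> Pol I" "g \<in> Pol I" for f g x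
      using Tr_add[OF \<tau>[OF that(1)] \<tau>[OF that(2)]]
      by (simp add: twisted_trace_def distrib_left)
    show "?\<Phi> (\<lambda>x. f x ^ p * g x) x = f x * ?\<Phi> g x" if "f \<in> Pol I" "g \<in> Pol I" for f g x
      using Tr_pth_power_mult[OF that(1) \<tau>[OF that(2)], of x]
      by (simp add: twisted_trace_def mult_ac)
    show "?\<Phi> (\<lambda>x. 1) x = 1" for x
      by (simp add: c)
    show "?\<Phi> f (elem i j t x) = ?\<Phi> f x"
      if "f \<in> Pol I" "\<And>i j t x. i < n \<Longrightarrow> j < n \<Longrightarrow> i \<noteq> j \<Longrightarrow> f (elem i j t x) = f x"
        "i < n" "j < n" "i \<noteq> j" for f i j t x
      using twisted_trace_elem[OF that] by simp
  qed
qed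

end

section \<open>Generation of the special linear group by transvections\<close>

text \<open>A permutation other than the identity moves at least two indices. One of them is not
  sent to \<open>r\<close>, and its entry is an off-diagonal 0.\<close>

lemma ldet_identity_except_column:
  assumes "finite S" "r \<in> S" "\<And>a c. a \<in> S \<Longrightarrow> c \<in> S \<Longrightarrow> c \<noteq> r \<Longrightarrow> M a c = (if a = c then 1 else 0)"
  shows "ldet S M = M r r"
proof -
  have zero: "(\<Prod>a\<in>S. M a (\<pi> a)) = 0" if \<pi>: "\<pi> permutes S" "\<pi> \<noteq> id" for \<pi>
  proof -
    have "\<exists>a\<in>S. \<pi> a \<noteq> r \<and> \<pi> a \<noteq> a"
    proof (rule ccontr)
      assume "\<not> ?thesis"
      then have *: "\<pi> a = r \<or> \<pi> a = a" if "a \<in> S" for a using that by blast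
      then have r: "\<pi> r = r" using assms(2) by blast
      have "\<pi> a = a" for a
        using * r permutes_not_in[OF \<pi>(1)] injD[OF permutes_inj[OF \<pi>(1)]] by metis
      then show False using \<pi>(2) by auto
    qed
    then obtain a where "a \<in> S" "\<pi> a \<noteq> r" "\<pi> a \<noteq> a" by blast
    then show ?thesis
      using assms(1) assms(3)[of a "\<pi> a"] \<pi>(1) by (intro prod_zero) (auto simp: permutes_in_image)
  qed
  have "ldet S M = (\<Sum>\<pi>\<in>{id}. of_int (sign \<pi>) * (\<Prod>a\<in>S. M a (\<pi> a)))"
    unfolding ldet_def using zero finite_permutations[OF assms(1)]
    by (intro sum.mono_neutral_right) (auto simp: permutes_id)
  also have "\<dots> = (\<Prod>a\<in>S. M a a)" by simp
  also have "\<dots> = M r r * (\<Prod>a\<in>S - {r}. M a a)"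
    using assms(1,2) by (rule prod.remove)
  also have "(\<Prod>a\<in>S - {r}. M a a) = 1"
    by (intro prod.neutral) (use assms(3) in auto)
  finally show ?thesis by simp
qed

locale based_space = finite_dimensional_vector_space scale B
  for scale :: "'k::field \<Rightarrow> 'v::ab_group_add \<Rightarrow> 'v" and B +
  fixes n :: nat and b :: "nat \<Rightarrow> 'v"
  assumes b_bij: "bij_betw b {..<n} B"
begin

definition coord_of :: "nat \<Rightarrow> 'v \<Rightarrow> 'k" where
  "coord_of i v = representation B v (b i)"

lemma b_in_B: "i < n \<Longrightarrow> b i \<in> B"
  using b_bij by (auto simp: bij_betw_def)

lemma b_eq_iff: "i < n \<Longrightarrow> j < n \<Longrightarrow> b i = b j \<longleftrightarrow> i = j"
  using b_bij by (auto simp: bij_betw_def inj_on_def)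

lemma coord_of_add: "coord_of i (u + v) = coord_of i u + coord_of i v"
  and coord_of_diff: "coord_of i (u - v) = coord_of i u - coord_of i v"
  and coord_of_scale: "coord_of i (scale c v) = c * coord_of i v"
  and coord_of_sum: "coord_of i (\<Sum>a\<in>A. f a) = (\<Sum>a\<in>A. coord_of i (f a))"
  by (simp_all add: coord_of_def representation_add representation_diff representation_scale
      representation_sum       independent_Basis span_Basis)

lemma coord_of_b: "i < n \<Longrightarrow> j < n \<Longrightarrow> coord_of i (b j) = (if i = j then 1 else 0)"
  by (simp add: coord_of_def representation_basis independent_Basis b_in_B b_eq_iff)

lemma coord_expansion: "(\<Sum>i<n. scale (coord_of i v) (b i)) = v"
proof -
  have "(\<Sum>i<n. scale (coord_of i v) (b i)) = (\<Sum>a\<in>B. scale (representation B v a) a)"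
    unfolding coord_of_def by (rule sum.reindex_bij_betw[OF b_bij])
  also have "\<dots> = v"
    by (rule sum_representation_eq) (simp_all add: independent_Basis span_Basis finite_Basis)
  finally show ?thesis .
qed

lemma coord_eqI: "(\<And>i. i < n \<Longrightarrow> coord_of i u = coord_of i v) \<Longrightarrow> u = v"
  using coord_expansion[of u] coord_expansion[of v] by (metis (no_types, lifting) lessThan_iff sum.cong)

lemma coord_of_combination: "i < n \<Longrightarrow> coord_of i (\<Sum>j<n. scale (c j) (b j)) = c i"
  by (simp add: coord_of_sum coord_of_scale coord_of_b if_distrib[of "(*) _"] cong: if_cong)

lemma linear_combination:
  assumes "Vector_Spaces.linear scale s f"
  shows "f v = (\<Sum>i<n. s (coord_of i v) (f (b i)))"
proof -
  interpret f: Vector_Spaces.linear scale s f by fact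
  show ?thesis
    by (subst coord_expansion[of v, symmetric]) (simp add: f.sum f.scale)
qed

definition transvection :: "nat \<Rightarrow> nat \<Rightarrow> 'k \<Rightarrow> 'v \<Rightarrow> 'v" where
  "transvection i j t v = v + scale (t * coord_of j v) (b i)"

lemma linear_transvection: "Vector_Spaces.linear scale scale (transvection i j t)"
  unfolding Vector_Spaces.linear_iff transvection_def
  by (auto simp: vector_space_axioms coord_of_add coord_of_scale algebra_simps)

lemma transvection_inverse:
  assumes "i < n" "j < n" "i \<noteq> j"
  shows "transvection i j t (transvection i j (- t) v) = v"
  using assms by (simp add: transvection_def coord_of_add coord_of_diff coord_of_scale coord_of_b)

lemma bij_transvection:
  assumes "i < n" "j < n" "i \<noteq> j"
  shows "bij (transvection i j t)" "Hilbert_Choice.inv (transvection i j t) = transvection i j (- t)"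
proof -
  show 1: "bij (transvection i j t)"
    using transvection_inverse[OF assms, of t] transvection_inverse[OF assms, of "- t"]
    by (intro bij_betw_byWitness[where f' = "transvection i j (- t)"]) auto
  show "Hilbert_Choice.inv (transvection i j t) = transvection i j (- t)"
    using transvection_inverse[OF assms, of t] 1 by (metis bij_inv_eq_iff ext)
qed

lemma transvection_b:
  "i < n \<Longrightarrow> j < n \<Longrightarrow> l < n \<Longrightarrow>
    transvection i j t (b l) = (if l = j then b j + scale t (b i) else b l)"
  by (simp add: transvection_def coord_of_b)

lemma endo_det_ldet: "endo_det scale B g = ldet B (\<lambda>a. representation B (g a))"
  by (simp add: endo_det_def ldet_def)

text \<open>The rows of the matrix are the images of the basis vectors, and the transvection adds t
  times the row of \<open>b i\<close> to that of \<open>b j\<close>.\<close>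

lemma endo_det_comp_transvection:
  assumes "Vector_Spaces.linear scale scale g" "i < n" "j < n" "i \<noteq> j"
  shows "endo_det scale B (g \<circ> transvection i j t) = endo_det scale B g"
proof -
  interpret g: Vector_Spaces.linear scale scale g by fact
  let ?M = "\<lambda>a. representation B (g a)"
  have "ldet B (\<lambda>a. representation B (g (transvection i j t a))) =
      ldet B (?M(b j := \<lambda>c. ?M (b j) c + t * ?M (b i) c))"
  proof (rule ldet_cong)
    fix a c assume "a \<in> B" "c \<in> B"
    then obtain l where l: "l < n" "a = b l"
      using b_bij by (auto simp: bij_betw_def)
    show "representation B (g (transvection i j t a)) c =
        (?M(b j := \<lambda>c. ?M (b j) c + t * ?M (b i) c)) a c"
      using assms l
      by (simp add: transvection_b b_eq_iff g.add g.scale representation_add representation_scale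
          independent_Basis span_Basis)
  qed
  also have "\<dots> = ldet B ?M"
    by (rule ldet_add_row) (use assms b_in_B b_eq_iff finite_Basis in auto)
  finally show ?thesis by (simp add: endo_det_ldet)
qed

lemma special_linear_comp_transvection:
  assumes "g \<in> special_linear scale B" "i < n" "j < n" "i \<noteq> j"
  shows "g \<circ> transvection i j t \<in> special_linear scale B"
  using assms endo_det_comp_transvection[of g i j t] bij_transvection(1)[of i j t]
    linear_transvection[of i j t]
  by (auto simp: special_linear_def intro: Vector_Spaces.linear_compose bij_comp)

lemma id_special_linear: "id \<in> special_linear scale B"
proof -
  have "endo_det scale B id = 1"
  proof (cases "B = {}")
    case True
    then show ?thesis by (simp add: endo_det_def)
  next
    case False
    then obtain r where "r \<in> B" by blast
    then show ?thesis
      unfolding endo_det_ldet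
      by (subst ldet_identity_except_column[of B r])
         (auto simp: finite_Basis representation_basis independent_Basis)
  qed
  then show ?thesis
    by (simp add: special_linear_def Vector_Spaces.linear_iff vector_space_axioms)
qed

lemma transvection_special_linear:
  "i < n \<Longrightarrow> j < n \<Longrightarrow> i \<noteq> j \<Longrightarrow> transvection i j t \<in> special_linear scale B"
  using special_linear_comp_transvection[OF id_special_linear] by simp

text \<open>Gaussian elimination by right multiplication: \<open>coord_of i (g (b l))\<close> is viewed as the entry in
  row \<open>l\<close> and column \<open>i\<close>, and composing with \<open>transvection i j t\<close> adds \<open>t\<close> times row \<open>i\<close> to
  row \<open>j\<close>.\<close>

definition cleared :: "nat \<Rightarrow> ('v \<Rightarrow> 'v) \<Rightarrow> bool" where
  "cleared r g \<longleftrightarrow> (\<forall>i<r. \<forall>l<n. coord_of i (g (b l)) = (if i = l then 1 else 0))"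

lemma coord_of_comp_transvection:
  assumes "g \<in> special_linear scale B" "i < n" "j < n" "l < n"
  shows "coord_of c ((g \<circ> transvection i j t) (b l)) =
    coord_of c (g (b l)) + (if l = j then t * coord_of c (g (b i)) else 0)"
proof -
  interpret g: Vector_Spaces.linear scale scale g
    using assms(1) by (simp add: special_linear_def)
  show ?thesis
    using assms by (simp add: transvection_b g.add g.scale coord_of_add coord_of_scale)
qed

text \<open>A row with index at least \<open>r\<close> vanishes in the first \<open>r\<close>
  columns, so adding it elsewhere leaves these columns alone.\<close>

lemma cleared_comp_transvection:
  assumes "g \<in> special_linear scale B" "cleared r g" "r \<le> i" "i < n" "j < n"
  shows "cleared r (g \<circ> transvection i j t)"
  unfolding cleared_def
proof (intro allI impI)
  fix c l assume "c < r" "l < n"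
  then show "coord_of c ((g \<circ> transvection i j t) (b l)) = (if c = l then 1 else 0)"
    using assms(2-5) unfolding coord_of_comp_transvection[OF assms(1,4,5) \<open>l < n\<close>]
    by (auto simp: cleared_def)
qed

text \<open>Elimination carries \<open>g\<close> to the identity by right multiplications;
  \<open>comp\<close> leads back from each product to the factor \<open>g\<close>.\<close>

lemma special_linear_induct [consumes 1, case_names id comp]:
  assumes "g \<in> special_linear scale B"
    and id: "P id"
    and comp: "\<And>g i j t. g \<in> special_linear scale B \<Longrightarrow> i < n \<Longrightarrow> j < n \<Longrightarrow> i \<noteq> j \<Longrightarrow>
      P (g \<circ> transvection i j t) \<Longrightarrow> P g"
  shows "P g"
proof -
  let ?SL = "special_linear scale B"
  let ?N = "\<lambda>g l i. coord_of i (g (b l))"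
  note row = coord_of_comp_transvection
  note SL = special_linear_comp_transvection
  \<comment> \<open>Downward induction: \<open>cleared n g\<close> makes \<open>g\<close> the
    identity, and \<open>cleared 0 g\<close> is no restriction.\<close>
  have "\<forall>g\<in>?SL. cleared r g \<longrightarrow> P g" if "r \<le> n" for r
    using that
  proof (induction r rule: inc_induct)
    case base
    show ?case
    proof (intro ballI impI)
      fix g assume g: "g \<in> ?SL" "cleared n g"
      have "g (b l) = b l" if "l < n" for l
        by (rule coord_eqI) (use g that in \<open>auto simp: cleared_def coord_of_b\<close>)
      then have "g v = v" for v
        using linear_combination[of scale g v] g(1) coord_expansion[of v]
        by (simp add: special_linear_def)
      then show "P g" using id by (metis eq_id_iff)
    qed
  next
    case (step r)
    have r: "r < n" by fact
    \<comment> \<open>With pivot 1, the other entries of column \<open>r\<close> are cleared one row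
      at a time, \<open>k\<close> counting the rows already treated.\<close>
    have clear: "\<forall>g\<in>?SL. cleared r g \<and> ?N g r r = 1 \<and> (\<forall>l<k. l \<noteq> r \<longrightarrow> ?N g l r = 0) \<longrightarrow> P g"
      if "k \<le> n" for k
      using that
    proof (induction k rule: inc_induct)
      case base
      show ?case
      proof (intro ballI impI)
        fix g assume g: "g \<in> ?SL" "cleared r g \<and> ?N g r r = 1 \<and> (\<forall>l<n. l \<noteq> r \<longrightarrow> ?N g l r = 0)"
        then have "cleared (Suc r) g" by (auto simp: cleared_def less_Suc_eq)
        then show "P g" using step.IH g(1) by blast
      qed
    next
      case (step k)
      show ?case
      proof (intro ballI impI)
        fix g assume g: "g \<in> ?SL" "cleared r g \<and> ?N g r r = 1 \<and> (\<forall>l<k. l \<noteq> r \<longrightarrow> ?N g l r = 0)"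
        show "P g"
        proof (cases "k = r")
          case True
          then show ?thesis using g step.IH by (auto simp: less_Suc_eq)
        next
          case False
          let ?g = "g \<circ> transvection r k (- ?N g k r)"
          have "?g \<in> ?SL" using g(1) r step.hyps False by (intro SL) auto
          moreover have "cleared r ?g"
            using g r step.hyps by (intro cleared_comp_transvection) auto
          moreover have "?N ?g r r = 1" "\<forall>l<Suc k. l \<noteq> r \<longrightarrow> ?N ?g l r = 0"
            using g r step.hyps False by (auto simp: row less_Suc_eq simp del: comp_apply)
          ultimately have "P ?g" using step.IH by blast
          then show ?thesis using comp[OF g(1) r] step.hyps False by blast
        qed
      qed
    qed
    have pivot_1: "P g" if "g \<in> ?SL" "cleared r g" "?N g r r = 1" for g
      using clear[of 0] that by blast
    \<comment> \<open>Rows cannot be rescaled by transvections, so the pivot is made 1 by adding a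
      multiple of a lower row with nonzero entry.\<close>
    have pivot_below: "P g" if g: "g \<in> ?SL" "cleared r g" and l: "r < l" "l < n" "?N g l r \<noteq> 0" for g l
    proof -
      let ?g = "g \<circ> transvection l r ((1 - ?N g r r) / ?N g l r)"
      have "P ?g"
      proof (rule pivot_1)
        show "?g \<in> ?SL" using g r l by (intro SL) auto
        show "cleared r ?g" using g r l by (intro cleared_comp_transvection) auto
        show "?N ?g r r = 1" using g r l by (simp add: row del: comp_apply)
      qed
      then show ?thesis using comp[OF g(1) l(2) r] l(1) by blast
    qed
    show ?case
    proof (intro ballI impI)
      fix g assume g: "g \<in> ?SL" "cleared r g"
      show "P g"
      proof (cases "Suc r < n")
        case False
        \<comment> \<open>At the last column the other columns are those of the identity, so the
          pivot is the determinant and equals 1.\<close>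
        then have n: "n = Suc r" using r by simp
        have "endo_det scale B g = representation B (g (b r)) (b r)"
          unfolding endo_det_ldet
        proof (rule ldet_identity_except_column)
          fix a c assume "a \<in> B" "c \<in> B" "c \<noteq> b r"
          then obtain l i where li: "l < n" "a = b l" "i < n" "c = b i" "i \<noteq> r"
            using b_bij by (auto simp: bij_betw_def)
          moreover from this have "i < r" using n by simp
          ultimately have "?N g l i = (if i = l then 1 else 0)"
            using g(2) unfolding cleared_def by blast
          then show "representation B (g a) c = (if a = c then 1 else 0)"
            using li by (auto simp: coord_of_def b_eq_iff)
        qed (use r b_in_B finite_Basis in auto)
        then show ?thesis
          using g by (intro pivot_1) (auto simp: special_linear_def coord_of_def)
      next
        case True
        show ?thesis
        proof (cases "\<exists>l. r < l \<and> l < n \<and> ?N g l r \<noteq> 0")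
          case True
          then show ?thesis using pivot_below[OF g] by blast
        next
          case False
          \<comment> \<open>If column \<open>r\<close> vanished from row \<open>r\<close> on, a
            preimage of \<open>b r\<close> would have zero coordinates before \<open>r\<close>, and
            the r-th coordinate of its image would be 0.\<close>
          have "?N g r r \<noteq> 0"
          proof
            assume "?N g r r = 0"
            with False have zero: "?N g l r = 0" if "r \<le> l" "l < n" for l
              using that by (cases "l = r") auto
            have "surj g" using g(1) by (simp add: special_linear_def bij_is_surj)
            then obtain u where u: "b r = g u" by (rule surjE)
            have lin: "Vector_Spaces.linear scale scale g"
              using g(1) by (simp add: special_linear_def)
            have co: "coord_of i (b r) = (\<Sum>l<n. coord_of l u * ?N g l i)" for i
              unfolding u by (subst linear_combination[OF lin]) (simp add: coord_of_sum coord_of_scale)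
            have u0: "coord_of i u = 0" if "i < r" for i
            proof -
              have "coord_of i (b r) = (\<Sum>l<n. if l = i then coord_of i u else 0)"
                unfolding co using g(2) that by (intro sum.cong) (auto simp: cleared_def)
              then show ?thesis using that r by (simp add: coord_of_b)
            qed
            have "coord_of r (b r) = 0"
              unfolding co
            proof (intro sum.neutral ballI)
              fix l assume "l \<in> {..<n}"
              then show "coord_of l u * ?N g l r = 0"
                using u0[of l] zero[of l] by (cases "l < r") auto
            qed
            then show False using r by (simp add: coord_of_b)
          qed
          \<comment> \<open>Adding row \<open>r\<close> to row \<open>Suc r\<close> creates a
            nonzero entry below the pivot, the case already treated.\<close>
          let ?g = "g \<circ> transvection r (Suc r) 1"
          have "P ?g"
          proof (rule pivot_below)
            show "?g \<in> ?SL" using g r True by (intro SL) auto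
            show "cleared r ?g" using g r True by (intro cleared_comp_transvection) auto
            show "?N ?g (Suc r) r \<noteq> 0"
              using g r True False \<open>?N g r r \<noteq> 0\<close> by (simp add: row del: comp_apply)
          qed (use True in auto)
          then show ?thesis using comp[OF g(1) r True] by simp
        qed
      qed
    qed
  qed
  from this[of 0] show ?thesis
    using assms(1) by (simp add: cleared_def)
qed

end

section \<open>Coordinates on the representation\<close>

locale sl_space = based_space scale B n b
  for scale :: "'k::field \<Rightarrow> 'v::ab_group_add \<Rightarrow> 'v" and B n b +
  fixes m q :: nat
begin

abbreviation W :: "('k, 'v) point set" where "W \<equiv> Vmq scale m q"
abbreviation PF :: "(('k, 'v) point \<Rightarrow> 'k) set" where
  "PF \<equiv> polynomial_functions W (Vmq_plus m q) (Vmq_smul scale m q)"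

definition pt :: "(coord \<Rightarrow> 'k) \<Rightarrow> ('k, 'v) point" where
  "pt x = ((\<lambda>a\<in>{..<m}. \<Sum>i<n. scale (x (X i a)) (b i)),
    (\<lambda>j\<in>{..<q}. \<lambda>v. \<Sum>i<n. x (Y i j) * coord_of i v))"

text \<open>Inverse to \<open>pt\<close> when coordinate functions are compared on
  \<open>coords n m q\<close> only; \<open>Pol_cong\<close> and \<open>pt_cong\<close> bridge the
  difference.\<close>

definition crd :: "('k, 'v) point \<Rightarrow> coord \<Rightarrow> 'k" where
  "crd w v = (case v of X i a \<Rightarrow> coord_of i (fst w a) | Y i j \<Rightarrow> snd w j (b i))"

lemma linear_dual: "\<xi> \<in> dual_space scale \<longleftrightarrow>
    (\<forall>u v. \<xi> (u + v) = \<xi> u + \<xi> v) \<and> (\<forall>c v. \<xi> (scale c v) = c * \<xi> v)"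
proof -
  have "vector_space ((*) :: 'k \<Rightarrow> 'k \<Rightarrow> 'k)"
    by unfold_locales (simp_all add: algebra_simps)
  then show ?thesis
    by (simp add: dual_space_def Vector_Spaces.linear_iff vector_space_axioms)
qed

lemma pt_in_W: "pt x \<in> W"
  by (auto simp: pt_def Vmq_def linear_dual coord_of_add coord_of_scale sum.distrib distrib_left
      sum_distrib_left mult_ac)

lemma pt_crd:
  assumes "w \<in> W"
  shows "pt (crd w) = w"
proof -
  obtain v \<xi> where w: "w = (v, \<xi>)" by (cases w)
  have \<xi>: "\<xi> j \<in> dual_space scale" if "j < q" for j
    using assms that by (auto simp: w Vmq_def)
  have "(\<Sum>i<n. \<xi> j (b i) * coord_of i u) = \<xi> j u" if "j < q" for j u
    using linear_combination[of "(*)" "\<xi> j" u] \<xi>[OF that] by (simp add: dual_space_def mult.commute)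
  then show ?thesis
    using assms
    by (auto simp: pt_def crd_def w Vmq_def coord_expansion PiE_def extensional_def restrict_def fun_eq_iff)
qed

lemma crd_pt: "v \<in> coords n m q \<Longrightarrow> crd (pt x) v = x v"
  by (cases v) (auto simp: crd_def pt_def coord_of_combination coord_of_b if_distrib[of "(*) _"] cong: if_cong)

lemma pt_cong: "(\<And>v. v \<in> coords n m q \<Longrightarrow> x v = y v) \<Longrightarrow> pt x = pt y"
  by (auto simp: pt_def intro!: restrict_ext sum.cong)

lemma pt_add: "pt (\<lambda>v. x v + y v) = Vmq_plus m q (pt x) (pt y)"
  by (auto simp: pt_def Vmq_plus_def fun_eq_iff restrict_def scale_left_distrib sum.distrib distrib_right)

lemma pt_scale: "pt (\<lambda>v. c * x v) = Vmq_smul scale m q c (pt x)"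
  by (auto simp: pt_def Vmq_smul_def fun_eq_iff restrict_def scale_sum_right sum_distrib_left mult.assoc)

text \<open>The coefficient of a coordinate is the value of \<open>l\<close> at the corresponding
  unit point.\<close>

lemma functional_pt_Pol:
  assumes "l \<in> linear_functionals W (Vmq_plus m q) (Vmq_smul scale m q)"
  shows "(\<lambda>x. l (pt x)) \<in> Pol (coords n m q)"
proof -
  define e :: "coord \<Rightarrow> coord \<Rightarrow> 'k" where "e v = (\<lambda>u. if u = v then 1 else 0)" for v
  have add: "l (pt (\<lambda>v. x v + y v)) = l (pt x) + l (pt y)" for x y
    using assms pt_in_W by (simp add: pt_add linear_functionals_def)
  have scl: "l (pt (\<lambda>v. c * x v)) = c * l (pt x)" for c x
    using assms pt_in_W by (simp add: pt_scale linear_functionals_def)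
  have fin: "l (pt (\<lambda>v. if v \<in> S then x v else 0)) = (\<Sum>v\<in>S. x v * l (pt (e v)))" if "finite S" for S x
    using that
  proof (induction S rule: finite_induct)
    case empty
    show ?case using scl[of 0 x] by simp
  next
    case (insert v S)
    have eq: "(\<lambda>u. if u \<in> insert v S then x u else 0) =
        (\<lambda>u. x v * e v u + (if u \<in> S then x u else 0))"
      using insert.hyps by (auto simp: e_def fun_eq_iff)
    have "l (pt (\<lambda>u. if u \<in> insert v S then x u else 0)) =
        l (pt (\<lambda>u. x v * e v u)) + l (pt (\<lambda>u. if u \<in> S then x u else 0))"
      unfolding eq by (rule add)
    also have "\<dots> = x v * l (pt (e v)) + (\<Sum>v\<in>S. x v * l (pt (e v)))"
      unfolding insert.IH scl[of "x v" "e v"] by (rule refl)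
    finally show ?case using insert.hyps by (simp only: sum.insert not_False_eq_True)
  qed
  have "l (pt x) = (\<Sum>v\<in>coords n m q. x v * l (pt (e v)))" for x
    unfolding fin[OF finite_coords, symmetric] by (rule arg_cong[where f = l], rule pt_cong) simp
  then have "(\<lambda>x. l (pt x)) = (\<lambda>x. \<Sum>v\<in>coords n m q. x v * l (pt (e v)))"
    by (rule ext)
  moreover have "(\<lambda>x. \<Sum>v\<in>coords n m q. x v * l (pt (e v))) \<in> Pol (coords n m q)"
    by (intro Pol_sum Pol_mult Pol_var Pol_const finite_coords)
  ultimately show ?thesis
    by (rule ssubst[where P = "\<lambda>f. f \<in> Pol (coords n m q)"])
qed

lemma polynomial_function_pt_Pol:
  assumes "f \<in> PF"
  shows "(\<lambda>x. f (pt x)) \<in> Pol (coords n m q)"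
  using assms
proof induction
  case (functional l)
  then show ?case by (rule functional_pt_Pol)
qed (simp_all add: pt_in_W Pol_const Pol_add Pol_mult)

lemma Pol_crd_polynomial_function:
  assumes "F \<in> Pol (coords n m q)"
  shows "(\<lambda>w\<in>W. F (crd w)) \<in> PF"
  using finite_coords assms
proof (induction rule: Pol_induct)
  case (const c)
  show ?case by (rule polynomial_functions.const)
next
  case (var v)
  have "(\<lambda>w\<in>W. crd w v) \<in> linear_functionals W (Vmq_plus m q) (Vmq_smul scale m q)"
  proof -
    have pl: "Vmq_plus m q w w' \<in> W" "crd (Vmq_plus m q w w') v = crd w v + crd w' v"
      if w: "w \<in> W" "w' \<in> W" for w w'
    proof -
      have eq: "Vmq_plus m q w w' = pt (\<lambda>v. crd w v + crd w' v)"
        using pt_crd[OF w(1)] pt_crd[OF w(2)] by (simp add: pt_add)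
      show "Vmq_plus m q w w' \<in> W" unfolding eq by (rule pt_in_W)
      show "crd (Vmq_plus m q w w') v = crd w v + crd w' v"
        unfolding eq using var by (rule crd_pt)
    qed
    have sm: "Vmq_smul scale m q c w \<in> W" "crd (Vmq_smul scale m q c w) v = c * crd w v"
      if w: "w \<in> W" for c w
    proof -
      have eq: "Vmq_smul scale m q c w = pt (\<lambda>v. c * crd w v)"
        using pt_crd[OF w] by (simp add: pt_scale)
      show "Vmq_smul scale m q c w \<in> W" unfolding eq by (rule pt_in_W)
      show "crd (Vmq_smul scale m q c w) v = c * crd w v"
        unfolding eq using var by (rule crd_pt)
    qed
    show ?thesis
      by (auto simp: linear_functionals_def pl sm)
  qed
  then show ?case by (rule polynomial_functions.functional)
next
  case (add f g)
  have "(\<lambda>w\<in>W. (\<lambda>w\<in>W. f (crd w)) w + (\<lambda>w\<in>W. g (crd w)) w) \<in> PF"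
    by (rule polynomial_functions.add) fact+
  moreover have "(\<lambda>w\<in>W. (\<lambda>w\<in>W. f (crd w)) w + (\<lambda>w\<in>W. g (crd w)) w) = (\<lambda>w\<in>W. f (crd w) + g (crd w))"
    by (rule restrict_ext) simp
  ultimately show ?case by (simp only:)
next
  case (mult f g)
  have "(\<lambda>w\<in>W. (\<lambda>w\<in>W. f (crd w)) w * (\<lambda>w\<in>W. g (crd w)) w) \<in> PF"
    by (rule polynomial_functions.mult) fact+
  moreover have "(\<lambda>w\<in>W. (\<lambda>w\<in>W. f (crd w)) w * (\<lambda>w\<in>W. g (crd w)) w) = (\<lambda>w\<in>W. f (crd w) * g (crd w))"
    by (rule restrict_ext) simp
  ultimately show ?case by (simp only:)
qed

text \<open>A covector is composed with the inverse transvection, whose parameter is -t; this is the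
  sign in \<open>elem\<close>.\<close>

lemma act_transvection_pt:
  assumes ij: "i < n" "j < n" "i \<noteq> j"
  shows "act_point m q (transvection i j t) (pt x) = pt (elem i j t x)"
proof -
  have "transvection i j t (\<Sum>r<n. scale (x (X r a)) (b r)) = (\<Sum>r<n. scale (elem i j t x (X r a)) (b r))" for a
    by (rule coord_eqI)
       (use ij in \<open>simp add: transvection_def coord_of_add coord_of_scale coord_of_combination coord_of_b\<close>)
  moreover have "(\<Sum>r<n. x (Y r a) * coord_of r (transvection i j (- t) v)) =
      (\<Sum>r<n. elem i j t x (Y r a) * coord_of r v)" for a v
  proof -
    have "(\<Sum>r<n. x (Y r a) * coord_of r (transvection i j (- t) v)) =
        (\<Sum>r<n. x (Y r a) * coord_of r v) - (\<Sum>r<n. if r = i then t * x (Y i a) * coord_of j v else 0)"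
      unfolding sum_subtractf[symmetric]
      by (intro sum.cong) (use ij in \<open>auto simp: transvection_def coord_of_add coord_of_diff coord_of_scale coord_of_b algebra_simps\<close>)
    \<comment> \<open>The correction involves coordinate \<open>j\<close> of \<open>v\<close>, so
      collecting coefficients of the coordinates moves it from summand \<open>i\<close> to summand
      \<open>j\<close>.\<close>
    also have "(\<Sum>r<n. if r = i then t * x (Y i a) * coord_of j v else 0) =
        (\<Sum>r<n. if r = j then t * x (Y i a) * coord_of j v else 0)"
      using ij by simp
    also have "(\<Sum>r<n. x (Y r a) * coord_of r v) - \<dots> = (\<Sum>r<n. elem i j t x (Y r a) * coord_of r v)"
      unfolding sum_subtractf[symmetric] by (intro sum.cong) (auto simp: algebra_simps)
    finally show ?thesis .
  qed
  ultimately show ?thesis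
    by (auto simp: act_point_def pt_def bij_transvection(2)[OF ij] fun_eq_iff restrict_def comp_def)
qed

lemma carrier_SL_invariant_ring:
  "f \<in> carrier (SL_invariant_ring scale B m q) \<longleftrightarrow>
    f \<in> PF \<and> (\<forall>g\<in>special_linear scale B. act_function scale m q g f = f)"
  by (simp add: SL_invariant_ring_def Amq_def coordinate_ring_def)

lemma invariant_elem:
  assumes f: "f \<in> carrier (SL_invariant_ring scale B m q)" and ij: "i < n" "j < n" "i \<noteq> j"
  shows "f (pt (elem i j t x)) = f (pt x)"
proof -
  \<comment> \<open>The action on functions goes through the inverse, so parameter -t gives the
    substitution with parameter t.\<close>
  have "act_function scale m q (transvection i j (- t)) f = f"
    using f transvection_special_linear[OF ij] by (simp add: carrier_SL_invariant_ring)
  then have "f (act_point m q (Hilbert_Choice.inv (transvection i j (- t))) (pt x)) = f (pt x)"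
    using pt_in_W[of x] by (metis act_function_def restrict_apply')
  then show ?thesis
    by (simp add: bij_transvection(2)[OF ij] act_transvection_pt[OF ij])
qed

lemma act_point_comp:
  assumes "bij g" "bij h"
  shows "act_point m q (g \<circ> h) w = act_point m q g (act_point m q h w)"
  using assms by (cases w) (auto simp: act_point_def restrict_def fun_eq_iff o_inv_distrib)

text \<open>Transvections generate the special linear group, so invariance under elementary
  substitutions suffices.\<close>

lemma invariantI:
  assumes F: "F \<in> Pol (coords n m q)"
    and inv: "\<And>i j t x. i < n \<Longrightarrow> j < n \<Longrightarrow> i \<noteq> j \<Longrightarrow> F (elem i j t x) = F x"
  shows "(\<lambda>w\<in>W. F (crd w)) \<in> carrier (SL_invariant_ring scale B m q)"
proof -
  have crd_act: "F (crd (act_point m q (transvection i j t) w)) = F (crd w)"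
    if ij: "i < n" "j < n" "i \<noteq> j" and w: "w \<in> W" for i j t w
  proof -
    have "F (crd (act_point m q (transvection i j t) w)) = F (crd (pt (elem i j t (crd w))))"
      using act_transvection_pt[OF ij, of t "crd w"] pt_crd[OF w] by simp
    also have "\<dots> = F (elem i j t (crd w))"
      by (rule Pol_cong[OF F crd_pt])
    finally show ?thesis using inv[OF ij] by simp
  qed
  have act: "\<forall>w\<in>W. F (crd (act_point m q g w)) = F (crd w)" if "g \<in> special_linear scale B" for g
    using that
  proof (induction rule: special_linear_induct)
    case id
    have act_id: "act_point m q id w = w" if "w \<in> W" for w
      using that by (auto simp: act_point_def Vmq_def fun_eq_iff restrict_def PiE_def extensional_def)
    show ?case by (intro ballI) (simp only: act_id)
  next
    case (comp g i j t)
    show ?case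
    proof
      fix w assume w: "w \<in> W"
      \<comment> \<open>Undoing the transvection first makes the product with \<open>g\<close> at
        \<open>?u\<close> agree with \<open>g\<close> at \<open>w\<close>.\<close>
      let ?u = "act_point m q (transvection i j (- t)) w"
      have u: "?u \<in> W"
        using comp.hyps w by (intro act_point_closed linear_transvection bij_transvection(1))
      have "transvection i j t \<circ> transvection i j (- t) = id"
        using transvection_inverse[OF comp.hyps(2-4), of t] by auto
      then have "act_point m q (g \<circ> transvection i j t) ?u = act_point m q g w"
        using comp.hyps
        by (subst act_point_comp[symmetric])
           (auto simp: special_linear_def comp_assoc intro!: bij_comp bij_transvection(1))
      then show "F (crd (act_point m q g w)) = F (crd w)"
        using comp.IH u crd_act[OF comp.hyps(2-4) w] by metis
    qed
  qed
  have "act_function scale m q g (\<lambda>w\<in>W. F (crd w)) = (\<lambda>w\<in>W. F (crd w))"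
    if g: "g \<in> special_linear scale B" for g
  proof -
    have lb: "Vector_Spaces.linear scale scale g" "bij g"
      using g by (auto simp: special_linear_def)
    have "F (crd (act_point m q (Hilbert_Choice.inv g) w)) = F (crd w)" if w: "w \<in> W" for w
    proof -
      \<comment> \<open>Invariance under \<open>g\<close>, applied at this point, yields invariance
        under its inverse.\<close>
      let ?u = "act_point m q (Hilbert_Choice.inv g) w"
      have "act_point m q g ?u = act_point m q id w"
        using lb(2) by (simp add: act_point_comp[symmetric] bij_imp_bij_inv bij_is_surj surj_iff[THEN iffD1])
      also have "\<dots> = w"
        using w by (auto simp: act_point_def Vmq_def fun_eq_iff restrict_def PiE_def extensional_def)
      finally show ?thesis
        using act[OF g] special_linear_inv_closed[OF g w] by metis
    qed
    then show ?thesis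
      using special_linear_inv_closed[OF g]
      by (auto simp: act_function_def intro!: restrict_ext)
  qed
  then show ?thesis
    unfolding carrier_SL_invariant_ring using Pol_crd_polynomial_function[OF F] by blast
qed

end

section \<open>Transport of the splitting to the invariant ring\<close>

theorem theorem1p2:
  fixes scale :: "'k::alg_closed_field \<Rightarrow> 'v::ab_group_add \<Rightarrow> 'v"
    and B :: "'v set"
    and p n m q :: nat
  assumes "CHAR('k) = p" and "p > 0"
    and "finite_dimensional_vector_space scale B"
    and "vector_space.dim scale (UNIV :: 'v set) = n"
    and "m \<ge> 1" and "q \<ge> 1"
    and "m \<ge> n" and "q \<ge> n"
  shows "frobenius_split p (SL_invariant_ring scale B m q)"
proof -
  interpret V: finite_dimensional_vector_space scale B by fact
  have "card B = n" using assms(4) by simp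
  then obtain b where b: "bij_betw b {..<n} B"
    using ex_bij_betw_nat_finite[OF V.finite_Basis] by (metis atLeast0LessThan)
  interpret sl_space scale B n b m q by unfold_locales fact
  interpret C: sl_coords n m q p "TYPE('k)" by unfold_locales (use assms in auto)
  let ?R = "SL_invariant_ring scale B m q"
  obtain \<Phi> where \<Phi>: "\<And>f. f \<in> Pol C.I \<Longrightarrow> \<Phi> f \<in> Pol C.I"
    "\<And>f g x. f \<in> Pol C.I \<Longrightarrow> g \<in> Pol C.I \<Longrightarrow> \<Phi> (\<lambda>x. f x + g x) x = \<Phi> f x + \<Phi> g x"
    "\<And>f g x. f \<in> Pol C.I \<Longrightarrow> g \<in> Pol C.I \<Longrightarrow> \<Phi> (\<lambda>x. f x ^ p * g x) x = f x * \<Phi> g x"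
    "\<And>x. \<Phi> (\<lambda>x. 1 :: 'k) x = 1"
    "\<And>f i j t x. f \<in> Pol C.I \<Longrightarrow>
      (\<And>i j t x. i < n \<Longrightarrow> j < n \<Longrightarrow> i \<noteq> j \<Longrightarrow> f (elem i j t x) = f x) \<Longrightarrow>
      i < n \<Longrightarrow> j < n \<Longrightarrow> i \<noteq> j \<Longrightarrow> \<Phi> f (elem i j t x) = \<Phi> f x"
    using C.coordinate_splitting by blast
  \<comment> \<open>Functions on \<open>W\<close> are pulled back to coordinates by
    \<open>pt\<close>, split there, and returned by \<open>crd\<close>.\<close>
  define \<phi> where "\<phi> f = (\<lambda>w\<in>W. \<Phi> (\<lambda>x. f (pt x)) (crd w))" for f
  have Pol: "(\<lambda>x. f (pt x)) \<in> Pol C.I" if "f \<in> carrier ?R" for f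
    using that by (intro polynomial_function_pt_Pol) (simp add: carrier_SL_invariant_ring)
  have power: "(f [^]\<^bsub>?R\<^esub> k) (pt x) = f (pt x) ^ k" for f x and k :: nat
    by (induction k) (simp_all add: nat_pow_def SL_invariant_ring_def Amq_def coordinate_ring_def
        pt_in_W mult.commute)
  have ops: "(f \<oplus>\<^bsub>?R\<^esub> g) (pt x) = f (pt x) + g (pt x)"
    "(f \<otimes>\<^bsub>?R\<^esub> g) (pt x) = f (pt x) * g (pt x)" for f g x
    by (simp_all add: SL_invariant_ring_def Amq_def coordinate_ring_def pt_in_W)
  have "\<phi> f \<in> carrier ?R" if f: "f \<in> carrier ?R" for f
    unfolding \<phi>_def
    by (intro invariantI \<Phi>(1,5) Pol f invariant_elem)
  moreover have "\<phi> (f \<oplus>\<^bsub>?R\<^esub> g) = \<phi> f \<oplus>\<^bsub>?R\<^esub> \<phi> g" if "f \<in> carrier ?R" "g \<in> carrier ?R" for f g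
  proof -
    have "\<phi> (f \<oplus>\<^bsub>?R\<^esub> g) = (\<lambda>w\<in>W. \<phi> f w + \<phi> g w)"
      unfolding \<phi>_def ops using \<Phi>(2)[OF Pol[OF that(1)] Pol[OF that(2)]] by (intro restrict_ext) simp
    then show ?thesis by (simp add: SL_invariant_ring_def Amq_def coordinate_ring_def)
  qed
  moreover have "\<phi> (f [^]\<^bsub>?R\<^esub> p \<otimes>\<^bsub>?R\<^esub> g) = f \<otimes>\<^bsub>?R\<^esub> \<phi> g" if "f \<in> carrier ?R" "g \<in> carrier ?R" for f g
  proof -
    have "\<phi> (f [^]\<^bsub>?R\<^esub> p \<otimes>\<^bsub>?R\<^esub> g) = (\<lambda>w\<in>W. f w * \<phi> g w)"
      unfolding \<phi>_def ops power using \<Phi>(3)[OF Pol[OF that(1)] Pol[OF that(2)]]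
      by (intro restrict_ext) (simp add: pt_crd)
    then show ?thesis by (simp add: SL_invariant_ring_def Amq_def coordinate_ring_def)
  qed
  moreover have "\<phi> \<one>\<^bsub>?R\<^esub> = \<one>\<^bsub>?R\<^esub>"
    using \<Phi>(4) by (simp add: \<phi>_def SL_invariant_ring_def Amq_def coordinate_ring_def pt_in_W)
  ultimately show ?thesis
    unfolding frobenius_split_def by (intro bexI[of _ \<phi>]) auto
qed

end
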